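(* (H\"older inequality) Let $n\in\mathbb N$ and $\lambda\in[0,1]$. Let $f\in\mathcal A_r^n$ with primitive $F\in\mathcal B_r$. Let $h\in\mathcal{IBV}^{n-1}$ be such that $h=I^{n-1}[g]$ for $g\in\mathcal{BV}$. Then $$\Bigl|\int_{-\infty}^\infty fh\Bigr|\le\|F\|_\infty\|g\|_{\mathcal{BV}}=\|f\|_{a,n}\|h\|_{\mathcal{IBV}^{n-1}}.$$
   Context: Write $\overline{\mathbb R}=[-\infty,\infty]$. A function $F:\overline{\mathbb R}\to\mathbb R$ is regulated if the one-sided limits $F(x-),F(x+)$ exist in $\mathbb R$ for every $x\in\mathbb R$ and the limits $\lim_{x\to\pm\infty}F(x)$ exist in $\mathbb R$; by convention $F(\pm\infty)$ equals these limits (also for functions of bounded variation). $\mathcal B_r$ is the space of regulated $F$ with $F(-\infty)=0$ and $F(x)=F(x-)$ for all $x\in\mathbb R$; $\|F\|_\infty=\sup_{x\in\mathbb R}|F(x)|$. $\mathcal A_r^n$ is the set of distributions $f$ on $\mathbb R$ with $f=F^{(n)}$ (distributional derivative) for some $F\in\mathcal B_r$; $F$ is unique (the primitive of $f$) and $\|f\|_{a,n}=\|F\|_\infty$. $\mathcal{BV}$ is the set of functions $g:\overline{\mathbb R}\to\mathbb R$ of bounded variation $Vg<\infty$, with norm $\|g\|_{\mathcal{BV}}=\|g\|_\infty+Vg$. For $\lambda\in[0,1]$, $\mathcal{NBV}_\lambda$ is the set of $g\in\mathcal{BV}$ with $g(x)=(1-\lambda)g(x-)+\lambda g(x+)$ for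 all $x\in\mathbb R$. For locally integrable $q$, $I^0[q]=q$ and $I^m[q](x)=\int_0^xI^{m-1}[q](t)\,dt$; $\mathcal{IBV}^0=\mathcal{BV}$ and $\mathcal{IBV}^m=\{I^m[g]:g\in\mathcal{BV}\}$ for $m\ge1$. For $m\ge1$ the operator $I^m:\mathcal{NBV}_\lambda\to\mathcal{IBV}^m$ is a bijection, and $\|h\|_{\mathcal{IBV}^m}=\|(I^m)^{-1}h\|_\infty+V[(I^m)^{-1}h]$, with $(I^m)^{-1}h\in\mathcal{NBV}_\lambda$; $\|h\|_{\mathcal{IBV}^0}=\|h\|_{\mathcal{BV}}$. Integral: let $g_0=h$ if $n=1$, and if $n\ge2$ let $g_0\in\mathcal{NBV}_\lambda$ be the unique function with $h=I^{n-1}[g_0]$. Then $\int_{-\infty}^\infty fh=(-1)^{n-1}\int_{-\infty}^\infty g_0\,dF$, a Henstock--Stieltjes integral: $\int_{-\infty}^\infty g_0\,dF=A$ means that for each $\epsilon>0$ there is a gauge $\gamma$ (assigning to each $z\in\overline{\mathbb R}$ an open interval of $\overline{\mathbb R}$ containing $z$) such that $|\sum_ig_0(z_i)[F(x_i)-F(x_{i-1})]-A|<\epsilon$ for every partition $-\infty=x_0<\dots<x_N=\infty$ with tags $z_i\in[x_{i-1},x_i]\subset\gamma(z_i)$. The integral exists for all such $f$ and $h$.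
   Formalization: The equality of norm products is proved only for n=1 or g in NBV_λ, since for n≥2 it fails (g the indicator of {0} gives h=0). For all g in BV, |∫fh| ≤ ‖f‖‖h‖ ≤ ‖F‖‖g‖ is proved. *)

theory Defs
  imports "HOL-Analysis.Analysis"
begin

section \<open>Functions on the extended real line\<close>

definition left_lim :: "(ereal \<Rightarrow> real) \<Rightarrow> real \<Rightarrow> real" where
  "left_lim F x = Lim (at_left x) (\<lambda>t. F (ereal t))"

definition right_lim :: "(ereal \<Rightarrow> real) \<Rightarrow> real \<Rightarrow> real" where
  "right_lim F x = Lim (at_right x) (\<lambda>t. F (ereal t))"

text \<open>The convention that the values at \<open>\<plusminus>\<infinity>\<close> are the limits there (which exist in the reals).\<close>

definition ends_are_limits :: "(ereal \<Rightarrow> real) \<Rightarrow> bool" where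
  "ends_are_limits F \<longleftrightarrow>
     ((\<lambda>t. F (ereal t)) \<longlongrightarrow> F \<infinity>) at_top \<and> ((\<lambda>t. F (ereal t)) \<longlongrightarrow> F (-\<infinity>)) at_bot"

definition regulated :: "(ereal \<Rightarrow> real) \<Rightarrow> bool" where
  "regulated F \<longleftrightarrow>
     (\<forall>x::real. (\<exists>l. ((\<lambda>t. F (ereal t)) \<longlongrightarrow> l) (at_left x)) \<and>
                (\<exists>l. ((\<lambda>t. F (ereal t)) \<longlongrightarrow> l) (at_right x))) \<and>
     ends_are_limits F"

definition B_r :: "(ereal \<Rightarrow> real) set" where
  "B_r = {F. regulated F \<and> F (-\<infinity>) = 0 \<and> (\<forall>x::real. F (ereal x) = left_lim F x)}"

definition sup_norm :: "(ereal \<Rightarrow> real) \<Rightarrow> real" where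
  "sup_norm F = (SUP x::real. \<bar>F (ereal x)\<bar>)"

definition var_sums :: "(ereal \<Rightarrow> real) \<Rightarrow> real set" where
  "var_sums g = {(\<Sum>i<N. \<bar>g (x (Suc i)) - g (x i)\<bar>) | (x :: nat \<Rightarrow> ereal) N. \<forall>i<N. x i < x (Suc i)}"

definition variation :: "(ereal \<Rightarrow> real) \<Rightarrow> real" where
  "variation g = Sup (var_sums g)"

definition BV :: "(ereal \<Rightarrow> real) set" where
  "BV = {g. bdd_above (var_sums g) \<and> ends_are_limits g}"

definition BV_norm :: "(ereal \<Rightarrow> real) \<Rightarrow> real" where
  "BV_norm g = sup_norm g + variation g"

definition NBV :: "real \<Rightarrow> (ereal \<Rightarrow> real) set" where
  "NBV lam = {g \<in> BV. \<forall>x::real. g (ereal x) = (1 - lam) * left_lim g x + lam * right_lim g x}"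

section \<open>Iterated integrals\<close>

text \<open>The integral is signed, so it is the integral from \<open>0\<close> to \<open>x\<close> also for negative \<open>x\<close>.
  Only real \<open>x\<close> matter when \<open>m \<ge> 1\<close>; keeping the domain \<^typ>\<open>ereal\<close> makes
  \<open>I_op 0\<close> the identity on functions of bounded variation.  At \<open>x = \<plusminus>\<infinity>\<close> the value is
  the Lebesgue integral over the half-line if that exists, and \<open>0\<close> otherwise; in either case it
  is determined by the values of the integrand at real points almost everywhere.\<close>

primrec I_op :: "nat \<Rightarrow> (ereal \<Rightarrow> real) \<Rightarrow> ereal \<Rightarrow> real" where
  "I_op 0 q = q"
| "I_op (Suc m) q = (\<lambda>x. LBINT t=0..x. I_op m q (ereal t))"

definition IBV :: "nat \<Rightarrow> (ereal \<Rightarrow> real) set" where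
  "IBV m = I_op m ` BV"

text \<open>The function \<open>g\<^sub>0\<close> with \<open>h = I_op m g\<^sub>0\<close>, normalised if \<open>m \<ge> 1\<close>.\<close>

definition I_inv :: "real \<Rightarrow> nat \<Rightarrow> (ereal \<Rightarrow> real) \<Rightarrow> ereal \<Rightarrow> real" where
  "I_inv lam m h = (if m = 0 then h else inv_into (NBV lam) (I_op m) h)"

definition IBV_norm :: "real \<Rightarrow> nat \<Rightarrow> (ereal \<Rightarrow> real) \<Rightarrow> real" where
  "IBV_norm lam m h = BV_norm (I_inv lam m h)"

section \<open>Distributions on the real line\<close>

definition test_function :: "(real \<Rightarrow> real) \<Rightarrow> bool" where
  "test_function \<phi> \<longleftrightarrow>
     (\<forall>k x. (deriv ^^ k) \<phi> differentiable (at x)) \<and> (\<exists>a b. \<forall>x. x \<notin> {a..b} \<longrightarrow> \<phi> x = 0)"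

definition test_null_sequence :: "(nat \<Rightarrow> real \<Rightarrow> real) \<Rightarrow> bool" where
  "test_null_sequence \<Phi> \<longleftrightarrow>
     (\<forall>j. test_function (\<Phi> j)) \<and>
     (\<exists>a b. \<forall>j x. x \<notin> {a..b} \<longrightarrow> \<Phi> j x = 0) \<and>
     (\<forall>k. uniform_limit UNIV (\<lambda>j. (deriv ^^ k) (\<Phi> j)) (\<lambda>x. 0) sequentially)"

text \<open>Distributions are functionals on test functions; they are set to \<open>0\<close> elsewhere so that
  equality of functionals is equality of distributions.\<close>

definition distribution :: "((real \<Rightarrow> real) \<Rightarrow> real) \<Rightarrow> bool" where
  "distribution T \<longleftrightarrow>
     (\<forall>\<phi>. \<not> test_function \<phi> \<longrightarrow> T \<phi> = 0) \<and>
     (\<forall>\<phi> \<psi> a b. test_function \<phi> \<longrightarrow> test_function \<psi> \<longrightarrow>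
        T (\<lambda>x. a * \<phi> x + b * \<psi> x) = a * T \<phi> + b * T \<psi>) \<and>
     (\<forall>\<Phi>. test_null_sequence \<Phi> \<longrightarrow> (\<lambda>j. T (\<Phi> j)) \<longlonglongrightarrow> 0)"

definition distr_of :: "(ereal \<Rightarrow> real) \<Rightarrow> (real \<Rightarrow> real) \<Rightarrow> real" where
  "distr_of F = (\<lambda>\<phi>. if test_function \<phi> then LBINT x. F (ereal x) * \<phi> x else 0)"

definition distr_deriv :: "((real \<Rightarrow> real) \<Rightarrow> real) \<Rightarrow> (real \<Rightarrow> real) \<Rightarrow> real" where
  "distr_deriv T = (\<lambda>\<phi>. if test_function \<phi> then - T (deriv \<phi>) else 0)"

definition A_r :: "nat \<Rightarrow> ((real \<Rightarrow> real) \<Rightarrow> real) set" where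
  "A_r n = {f. distribution f \<and> (\<exists>F\<in>B_r. f = (distr_deriv ^^ n) (distr_of F))}"

definition primitive :: "nat \<Rightarrow> ((real \<Rightarrow> real) \<Rightarrow> real) \<Rightarrow> ereal \<Rightarrow> real" where
  "primitive n f = (THE F. F \<in> B_r \<and> f = (distr_deriv ^^ n) (distr_of F))"

definition A_norm :: "nat \<Rightarrow> ((real \<Rightarrow> real) \<Rightarrow> real) \<Rightarrow> real" where
  "A_norm n f = sup_norm (primitive n f)"

section \<open>The integral\<close>

definition ereal_gauge :: "(ereal \<Rightarrow> ereal set) \<Rightarrow> bool" where
  "ereal_gauge \<gamma> \<longleftrightarrow> (\<forall>z. open (\<gamma> z) \<and> connected (\<gamma> z) \<and> z \<in> \<gamma> z)"

definition tagged_partition ::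
    "nat \<Rightarrow> (nat \<Rightarrow> ereal) \<Rightarrow> (nat \<Rightarrow> ereal) \<Rightarrow> bool" where
  "tagged_partition N x z \<longleftrightarrow>
     x 0 = -\<infinity> \<and> x N = \<infinity> \<and> (\<forall>i<N. x i < x (Suc i) \<and> z i \<in> {x i..x (Suc i)})"

definition has_HS_integral :: "(ereal \<Rightarrow> real) \<Rightarrow> (ereal \<Rightarrow> real) \<Rightarrow> real \<Rightarrow> bool" where
  "has_HS_integral g F A \<longleftrightarrow>
     (\<forall>\<epsilon>>0. \<exists>\<gamma>. ereal_gauge \<gamma> \<and>
        (\<forall>N x z. tagged_partition N x z \<and> (\<forall>i<N. {x i..x (Suc i)} \<subseteq> \<gamma> (z i)) \<longrightarrow>
           \<bar>(\<Sum>i<N. g (z i) * (F (x (Suc i)) - F (x i))) - A\<bar> < \<epsilon>))"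

definition HS_integral :: "(ereal \<Rightarrow> real) \<Rightarrow> (ereal \<Rightarrow> real) \<Rightarrow> real" where
  "HS_integral g F = (THE A. has_HS_integral g F A)"

text \<open>The integral of \<open>f h\<close> for \<open>f \<in> A_r n\<close> and \<open>h \<in> IBV (n - 1)\<close>, where \<open>n \<ge> 1\<close>.\<close>

definition A_integral ::
    "real \<Rightarrow> nat \<Rightarrow> ((real \<Rightarrow> real) \<Rightarrow> real) \<Rightarrow> (ereal \<Rightarrow> real) \<Rightarrow> real" where
  "A_integral lam n f h =
     (-1) ^ (n - 1) * HS_integral (I_inv lam (n - 1) h) (primitive n f)"

end

theory Submission
  imports Defs
begin

text \<open>Summation by parts bounds a Riemann--Stieltjes sum of \<open>g\<^sub>0\<close> with respect to \<open>F\<close> by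
  \<open>\<parallel>F\<parallel>\<close> times the \<open>BV\<close> norm of \<open>g\<^sub>0\<close>, because \<open>F (-\<infinity>) = 0\<close>. The same bound
  reduces existence of the integral to uniform approximation of \<open>F\<close> by left continuous step
  functions, for which the integral is a finite sum. The inverse of \<open>I\<^sup>m\<close> replaces \<open>g\<close> by its
  normalisation, which changes \<open>g\<close> at countably many points only and increases neither the
  supremum nor the variation. The primitive is unique because an iterated derivative of a bounded
  function that vanishes at \<open>-\<infinity>\<close> determines that function: translates of a test function
  differ by the derivative of a test function.\<close>

text \<open>\<open>HS_integral\<close>, \<open>primitive\<close> and \<open>I_inv\<close> are given
  by choice operators, so no estimate can start before each is identified: the integral by existence
  together with Cousin's lemma, the primitive by uniqueness, the inverse by injectivity on
  \<open>NBV lam\<close>. Existence rests on a feature of the summation by parts bound: it holds for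
  every tagged partition, fine or not. A uniform error in the integrator therefore costs the same in
  every sum, and a gauge found for a step function also serves for \<open>F\<close>. Jumps of the
  form \<open>x > c\<close> suffice because \<open>F\<close> is left continuous. What an indefinite
  integral remembers of a function of bounded variation is its one-sided limits, not its values;
  this is why injectivity is a matter of \<open>NBV lam\<close> and is proved through one-sided
  limits.\<close>

text \<open>The supremum \<open>s\<close> of the points with \<open>Q\<close> satisfies
  \<open>Q\<close> by \<open>left\<close>, and \<open>right\<close> would pass beyond it if
  \<open>s < \<infinity>\<close>. Cousin's lemma and the step approximation are both
  instances.\<close>

lemma ereal_left_right_induct:
  fixes Q :: "ereal \<Rightarrow> bool"
  assumes bot: "Q (-\<infinity>)"
    and left: "\<And>x. -\<infinity> < x \<Longrightarrow> \<exists>d<x. \<forall>b. d < b \<and> b < x \<and> Q b \<longrightarrow> Q x"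
    and right: "\<And>x. x < \<infinity> \<Longrightarrow> Q x \<Longrightarrow> \<exists>c>x. Q c"
  shows "Q \<infinity>"
proof -
  define s where "s = Sup {b. Q b}"
  have "Q s"
  proof (cases "s = -\<infinity>")
    case False
    then have "-\<infinity> < s" by auto
    from left[OF this] obtain d where d: "d < s" "\<And>b. d < b \<Longrightarrow> b < s \<Longrightarrow> Q b \<Longrightarrow> Q s"
      by blast
    obtain b where b: "Q b" "d < b"
      using d(1) unfolding s_def less_Sup_iff by auto
    have "b \<le> s" unfolding s_def using b by (auto intro: Sup_upper)
    then show ?thesis using d(2) b by (cases "b = s") auto
  qed (use bot in simp)
  show ?thesis
  proof (rule ccontr)
    assume "\<not> Q \<infinity>"
    then have "s < \<infinity>" using \<open>Q s\<close> by (cases "s = \<infinity>") auto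
    from right[OF this \<open>Q s\<close>] obtain c where "c > s" "Q c" by blast
    moreover have "c \<le> s" unfolding s_def using \<open>Q c\<close> by (auto intro: Sup_upper)
    ultimately show False by simp
  qed
qed

section \<open>The Henstock--Stieltjes integral\<close>

definition fine_partition ::
    "(ereal \<Rightarrow> ereal set) \<Rightarrow> nat \<Rightarrow> (nat \<Rightarrow> ereal) \<Rightarrow> (nat \<Rightarrow> ereal) \<Rightarrow> bool" where
  "fine_partition \<gamma> N x z \<longleftrightarrow>
     tagged_partition N x z \<and> (\<forall>i<N. {x i..x (Suc i)} \<subseteq> \<gamma> (z i))"

text \<open>Without fine partitions \<open>has_HS_integral\<close> would hold vacuously for every
  value. \<open>Q b\<close> says that \<open>[-\<infinity>, b]\<close> has a fine partition, which
  is prolonged by one interval at a time.\<close>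

lemma cousin_ereal:
  assumes "ereal_gauge \<gamma>"
  obtains N x z where "fine_partition \<gamma> N x z"
proof -
  define Q where "Q b \<longleftrightarrow> (\<exists>(N::nat) x z. x 0 = -\<infinity> \<and> x N = b \<and>
     (\<forall>i<N. x i < x (Suc i) \<and> z i \<in> {x i..x (Suc i)} \<and> {x i..x (Suc i)} \<subseteq> \<gamma> (z i)))" for b
  have extend: "Q c" if "Q b" "b < c" "{b..c} \<subseteq> \<gamma> w" "b \<le> w" "w \<le> c" for b c w
  proof -
    obtain N x z where *: "x 0 = -\<infinity>" "x N = b"
     "\<forall>i<N. x i < x (Suc i) \<and> z i \<in> {x i..x (Suc i)} \<and> {x i..x (Suc i)} \<subseteq> \<gamma> (z i)"
      using \<open>Q b\<close> unfolding Q_def by blast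
    show ?thesis unfolding Q_def
      apply (rule exI[of _ "Suc N"], rule exI[of _ "x(Suc N := c)"], rule exI[of _ "z(N := w)"])
      using * that by (auto simp: less_Suc_eq)
  qed
  have g: "open (\<gamma> z)" "z \<in> \<gamma> z" for z using assms unfolding ereal_gauge_def by auto
  have "Q \<infinity>"
  proof (rule ereal_left_right_induct)
    show "Q (-\<infinity>)" unfolding Q_def
      by (rule exI[of _ 0], rule exI[of _ "\<lambda>_. -\<infinity>"]) auto
  next
    fix x :: ereal assume "-\<infinity> < x"
    from open_left[OF g(1)[of x] g(2) this] obtain d where d: "d < x" "{d<..x} \<subseteq> \<gamma> x" by blast
    \<comment> \<open>The new interval is tagged at the limit point \<open>x\<close>, its right end
      here and its left end in the step to the right, because it is \<open>\<gamma> x\<close> that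
      is known to contain it.\<close>
    have "Q x" if "d < b" "b < x" "Q b" for b
      using that by (intro extend[of b x x] order_trans[OF _ d(2)]) auto
    then show "\<exists>d<x. \<forall>b. d < b \<and> b < x \<and> Q b \<longrightarrow> Q x" using d(1) by blast
  next
    fix x :: ereal assume "x < \<infinity>" "Q x"
    from open_right[OF g(1)[of x] g(2) this(1)] obtain b where b: "b > x" "{x..<b} \<subseteq> \<gamma> x" by blast
    obtain c where c: "x < c" "c < b" using dense b by blast
    have "Q c"
      using c by (intro extend[OF \<open>Q x\<close>, of c x] order_trans[OF _ b(2)]) auto
    then show "\<exists>c>x. Q c" using c by blast
  qed
  then obtain N x z where *: "x 0 = -\<infinity>" "x N = \<infinity>"
     "\<forall>i<N. x i < x (Suc i) \<and> z i \<in> {x i..x (Suc i)} \<and> {x i..x (Suc i)} \<subseteq> \<gamma> (z i)"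
    unfolding Q_def by blast
  have "fine_partition \<gamma> N x z" using * unfolding fine_partition_def tagged_partition_def by simp
  then show thesis by (rule that)
qed

text \<open>Connectedness is part of \<open>ereal_gauge\<close>; in this linear order it means order
  convexity, which intersections keep.\<close>

lemma ereal_gauge_Int:
  assumes "ereal_gauge \<gamma>" "ereal_gauge \<delta>"
  shows "ereal_gauge (\<lambda>z. \<gamma> z \<inter> \<delta> z)"
proof -
  have "connected (\<gamma> z \<inter> \<delta> z)" for z
  proof -
    have "connected (\<gamma> z)" "connected (\<delta> z)" using assms unfolding ereal_gauge_def by blast+
    note mem = this[THEN connected_iff_interval[THEN iffD1, rule_format]]
    show ?thesis unfolding connected_iff_interval by (intro ballI allI impI IntI; rule mem; assumption?; simp)
  qed
  then show ?thesis using assms unfolding ereal_gauge_def by (simp add: open_Int)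
qed

definition HS_sum :: "nat \<Rightarrow> (nat \<Rightarrow> ereal) \<Rightarrow> (nat \<Rightarrow> ereal) \<Rightarrow> (ereal \<Rightarrow> real) \<Rightarrow> (ereal \<Rightarrow> real) \<Rightarrow> real"
  where "HS_sum N x z g F = (\<Sum>i<N. g (z i) * (F (x (Suc i)) - F (x i)))"

lemma fine_partition_Int:
  "fine_partition (\<lambda>z. \<gamma> z \<inter> \<delta> z) N x z \<longleftrightarrow> fine_partition \<gamma> N x z \<and> fine_partition \<delta> N x z"
  unfolding fine_partition_def by auto

lemma has_HS_integral_iff:
  "has_HS_integral g F A \<longleftrightarrow> (\<forall>\<epsilon>>0. \<exists>\<gamma>. ereal_gauge \<gamma> \<and>
     (\<forall>N x z. fine_partition \<gamma> N x z \<longrightarrow> \<bar>HS_sum N x z g F - A\<bar> < \<epsilon>))"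
  unfolding has_HS_integral_def HS_sum_def fine_partition_def ..

lemma has_HS_integralD:
  assumes "has_HS_integral g F A" "\<epsilon> > 0"
  obtains \<gamma> where "ereal_gauge \<gamma>"
    "\<And>N x z. fine_partition \<gamma> N x z \<Longrightarrow> \<bar>HS_sum N x z g F - A\<bar> < \<epsilon>"
  using assms unfolding has_HS_integral_iff by blast

lemma has_HS_integral_common_partition:
  assumes "has_HS_integral g F A" "has_HS_integral k G B" "\<epsilon> > 0"
  obtains N x z where "tagged_partition N x z"
    "\<bar>HS_sum N x z g F - A\<bar> < \<epsilon>" "\<bar>HS_sum N x z k G - B\<bar> < \<epsilon>"
proof -
  obtain \<gamma> where \<gamma>: "ereal_gauge \<gamma>"
    "\<And>N x z. fine_partition \<gamma> N x z \<Longrightarrow> \<bar>HS_sum N x z g F - A\<bar> < \<epsilon>"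
    using has_HS_integralD[OF assms(1,3)] by blast
  obtain \<delta> where \<delta>: "ereal_gauge \<delta>"
    "\<And>N x z. fine_partition \<delta> N x z \<Longrightarrow> \<bar>HS_sum N x z k G - B\<bar> < \<epsilon>"
    using has_HS_integralD[OF assms(2,3)] by blast
  obtain N x z where "fine_partition (\<lambda>z. \<gamma> z \<inter> \<delta> z) N x z"
    using cousin_ereal[OF ereal_gauge_Int[OF \<gamma>(1) \<delta>(1)]] by blast
  then have *: "fine_partition \<gamma> N x z" "fine_partition \<delta> N x z" unfolding fine_partition_Int by auto
  then have "tagged_partition N x z" unfolding fine_partition_def by blast
  then show thesis using * \<gamma>(2) \<delta>(2) that by blast
qed

text \<open>On a common fine partition a bound for all sums becomes a bound for the integrals. With
  \<open>c = 0\<close> this gives uniqueness, with \<open>G = 0\<close> the bound for one integral,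
  and for two step functions the Cauchy property.\<close>

lemma has_HS_integral_bound:
  assumes "has_HS_integral g F A" "has_HS_integral g G B"
    and "\<And>N x z. tagged_partition N x z \<Longrightarrow> \<bar>HS_sum N x z g F - HS_sum N x z g G\<bar> \<le> c"
  shows "\<bar>A - B\<bar> \<le> c"
proof (rule field_le_epsilon)
  fix e :: real assume "e > 0"
  then have "e / 2 > 0" by simp
  from has_HS_integral_common_partition[OF assms(1,2) this] obtain N x z
    where *: "tagged_partition N x z"
    "\<bar>HS_sum N x z g F - A\<bar> < e/2" "\<bar>HS_sum N x z g G - B\<bar> < e/2" by blast
  show "\<bar>A - B\<bar> \<le> c + e" using * assms(3)[OF *(1)] by linarith
qed

lemma has_HS_integral_unique:
  assumes "has_HS_integral g F A" "has_HS_integral g F B"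
  shows "A = B"
  using has_HS_integral_bound[OF assms, of 0] by simp

lemma HS_integral_eq: "has_HS_integral g F A \<Longrightarrow> HS_integral g F = A"
  unfolding HS_integral_def using has_HS_integral_unique by blast

lemma has_HS_integral_zero: "has_HS_integral g (\<lambda>_. 0) 0"
  unfolding has_HS_integral_iff
  by (auto simp: HS_sum_def ereal_gauge_def intro!: exI[of _ "\<lambda>_. UNIV"])

lemma HS_sum_add_scaled:
  "HS_sum N x z g (\<lambda>x. F x + a * G x) = HS_sum N x z g F + a * HS_sum N x z g G"
  unfolding HS_sum_def by (simp add: sum_distrib_left sum.distrib[symmetric] algebra_simps)

lemma has_HS_integral_add_scaled:
  assumes "has_HS_integral g F A" "has_HS_integral g G B"
  shows "has_HS_integral g (\<lambda>x. F x + a * G x) (A + a * B)"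
  unfolding has_HS_integral_iff
proof (intro allI impI)
  fix \<epsilon> :: real assume "\<epsilon> > 0"
  define e where "e = \<epsilon> / (1 + \<bar>a\<bar>)"
  have e: "e > 0" "e * (1 + \<bar>a\<bar>) = \<epsilon>" using \<open>\<epsilon> > 0\<close> by (auto simp: e_def)
  obtain \<gamma> where \<gamma>: "ereal_gauge \<gamma>"
    "\<And>N x z. fine_partition \<gamma> N x z \<Longrightarrow> \<bar>HS_sum N x z g F - A\<bar> < e"
    using has_HS_integralD[OF assms(1) e(1)] by blast
  obtain \<delta> where \<delta>: "ereal_gauge \<delta>"
    "\<And>N x z. fine_partition \<delta> N x z \<Longrightarrow> \<bar>HS_sum N x z g G - B\<bar> < e"
    using has_HS_integralD[OF assms(2) e(1)] by blast
  have "\<bar>HS_sum N x z g (\<lambda>x. F x + a * G x) - (A + a * B)\<bar> < \<epsilon>"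
    if "fine_partition \<gamma> N x z" "fine_partition \<delta> N x z" for N x z
  proof -
    have "HS_sum N x z g (\<lambda>x. F x + a * G x) - (A + a * B) =
       (HS_sum N x z g F - A) + a * (HS_sum N x z g G - B)"
      unfolding HS_sum_add_scaled by (simp add: algebra_simps)
    also have "\<bar>\<dots>\<bar> \<le> \<bar>HS_sum N x z g F - A\<bar> + \<bar>a\<bar> * \<bar>HS_sum N x z g G - B\<bar>"
      by (metis abs_mult abs_triangle_ineq)
    also have "\<dots> < e + \<bar>a\<bar> * e"
      using \<gamma>(2)[OF that(1)] mult_left_mono[OF less_imp_le[OF \<delta>(2)[OF that(2)]], of "\<bar>a\<bar>"] by linarith
    finally show ?thesis using e(2) by (simp add: algebra_simps)
  qed
  then show "\<exists>\<gamma>. ereal_gauge \<gamma> \<and> (\<forall>N x z. fine_partition \<gamma> N x z \<longrightarrow>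
      \<bar>HS_sum N x z g (\<lambda>x. F x + a * G x) - (A + a * B)\<bar> < \<epsilon>)"
    using ereal_gauge_Int[OF \<gamma>(1) \<delta>(1)] fine_partition_Int by blast
qed

text \<open>A gauge that omits \<open>c\<close> away from the tag \<open>c\<close> forces the subinterval across the jump to be
  tagged at \<open>c\<close>.\<close>

lemma has_HS_integral_jump:
  fixes c :: ereal
  assumes "c < \<infinity>"
  shows "has_HS_integral g (\<lambda>x. if x > c then 1 else 0) (g c)"
  unfolding has_HS_integral_iff
proof (intro allI impI)
  fix \<epsilon> :: real assume "\<epsilon> > 0"
  let ?F = "\<lambda>x. if x > c then 1 else (0::real)"
  define \<gamma> where "\<gamma> z = (if z = c then UNIV else if z < c then {..<c} else {c<..})" for z
  have "ereal_gauge \<gamma>" unfolding ereal_gauge_def \<gamma>_def connected_iff_interval by auto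
  moreover have "HS_sum N x z g ?F = g c"
    if "fine_partition \<gamma> N x z" for N x z
  proof -
    have tp: "tagged_partition N x z" and fine: "\<forall>i<N. {x i..x (Suc i)} \<subseteq> \<gamma> (z i)"
      using that unfolding fine_partition_def by auto
    have tag: "g (z i) * (?F (x (Suc i)) - ?F (x i)) = g c * (?F (x (Suc i)) - ?F (x i))"
      if "i < N" for i
    proof (cases "x i \<le> c \<and> c < x (Suc i)")
      case True
      then have "c \<in> {x i..x (Suc i)}" by (simp add: less_imp_le)
      then have "c \<in> \<gamma> (z i)" using fine \<open>i < N\<close> by blast
      then have "z i = c" unfolding \<gamma>_def by (auto split: if_splits)
      then show ?thesis by simp
    next
      case False
      moreover have "x i < x (Suc i)" using tp that unfolding tagged_partition_def by auto
      ultimately show ?thesis by auto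
    qed
    have "HS_sum N x z g ?F = g c * (\<Sum>i<N. ?F (x (Suc i)) - ?F (x i))"
      unfolding HS_sum_def sum_distrib_left by (rule sum.cong[OF refl tag]) simp
    also have "(\<Sum>i<N. ?F (x (Suc i)) - ?F (x i)) = ?F (x N) - ?F (x 0)"
      by (rule sum_lessThan_telescope)
    also have "\<dots> = 1" using tp assms unfolding tagged_partition_def by auto
    finally show ?thesis by simp
  qed
  ultimately show "\<exists>\<gamma>. ereal_gauge \<gamma> \<and>
     (\<forall>N x z. fine_partition \<gamma> N x z \<longrightarrow> \<bar>HS_sum N x z g ?F - g c\<bar> < \<epsilon>)"
    using \<open>\<epsilon> > 0\<close> by (intro exI[of _ \<gamma>]) auto
qed

section \<open>Left continuous step functions and uniform approximation\<close>

text \<open>Built from left continuous unit jumps, so that integrability is a matter of one jump at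
  a time. The location \<open>c = -\<infinity>\<close> is allowed; it sets the value right after
  \<open>-\<infinity>\<close> while the function still vanishes there.\<close>

inductive_set step_functions :: "(ereal \<Rightarrow> real) set" where
  zero: "(\<lambda>_. 0) \<in> step_functions"
| jump: "s \<in> step_functions \<Longrightarrow> c < \<infinity> \<Longrightarrow>
    (\<lambda>x. s x + a * (if x > c then 1 else 0)) \<in> step_functions"

lemma step_HS_integrable: "s \<in> step_functions \<Longrightarrow> \<exists>A. has_HS_integral g s A"
proof (induction rule: step_functions.induct)
  case zero then show ?case using has_HS_integral_zero by blast
next
  case (jump s c a)
  then show ?case using has_HS_integral_add_scaled[OF _ has_HS_integral_jump[OF jump.hyps(2)]] by blast
qed

lemma step_minus_infinity: "s \<in> step_functions \<Longrightarrow> s (-\<infinity>) = 0"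
  by (induction rule: step_functions.induct) auto

lemma step_bounded: "s \<in> step_functions \<Longrightarrow> \<exists>M. \<forall>x. \<bar>s x\<bar> \<le> M"
proof (induction rule: step_functions.induct)
  case (jump s c a)
  then obtain M where M: "\<And>x. \<bar>s x\<bar> \<le> M" by blast
  have "\<bar>s x + a * (if x > c then 1 else 0)\<bar> \<le> M + \<bar>a\<bar>" for x
    using M[of x] by auto
  then show ?case by blast
qed auto

lemma step_measurable: "s \<in> step_functions \<Longrightarrow> (\<lambda>t. s (ereal t)) \<in> borel_measurable borel"
  by (induction rule: step_functions.induct) auto

text \<open>The two local hypotheses differ in form: left of \<open>x\<close> the constant must be
  \<open>F x\<close>, because the piece \<open>(b, x]\<close> contains \<open>x\<close>; right of
  \<open>x\<close> any \<open>l\<close> will do, because a jump at \<open>x\<close> takes effect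
  only after \<open>x\<close>.\<close>

lemma step_approximation:
  fixes F :: "ereal \<Rightarrow> real"
  assumes "F (-\<infinity>) = 0"
    and left: "\<And>x \<epsilon>. -\<infinity> < x \<Longrightarrow> \<epsilon> > 0 \<Longrightarrow> \<exists>d<x. \<forall>y. d < y \<and> y \<le> x \<longrightarrow> \<bar>F y - F x\<bar> \<le> \<epsilon>"
    and right: "\<And>x \<epsilon>. x < \<infinity> \<Longrightarrow> \<epsilon> > 0 \<Longrightarrow> \<exists>c>x. \<exists>l. \<forall>y. x < y \<and> y \<le> c \<longrightarrow> \<bar>F y - l\<bar> \<le> \<epsilon>"
    and "\<epsilon> > 0"
  shows "\<exists>s\<in>step_functions. \<forall>x. \<bar>F x - s x\<bar> \<le> \<epsilon>"
proof -
  \<comment> \<open>Since \<open>s\<close> stays constant from \<open>b\<close> on, one jump at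
    \<open>b\<close> of height \<open>v - s b\<close> sets the value \<open>v\<close> on the next
    piece.\<close>
  define Q where "Q b \<longleftrightarrow> (\<exists>s\<in>step_functions. (\<forall>x\<ge>b. s x = s b) \<and> (\<forall>x\<le>b. \<bar>F x - s x\<bar> \<le> \<epsilon>))" for b
  have extend: "Q c" if "Q b" "b < c" "\<And>y. b < y \<Longrightarrow> y \<le> c \<Longrightarrow> \<bar>F y - v\<bar> \<le> \<epsilon>" for b c v
  proof -
    obtain s where s: "s \<in> step_functions" "\<And>x. x \<ge> b \<Longrightarrow> s x = s b" "\<And>x. x \<le> b \<Longrightarrow> \<bar>F x - s x\<bar> \<le> \<epsilon>"
      using \<open>Q b\<close> unfolding Q_def by blast
    show ?thesis unfolding Q_def
    proof (rule bexI[of _ "\<lambda>x. s x + (v - s b) * (if x > b then 1 else 0)"])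
      show "(\<lambda>x. s x + (v - s b) * (if x > b then 1 else 0)) \<in> step_functions"
        using s(1) \<open>b < c\<close> by (intro step_functions.jump) auto
      have "\<bar>F x - (s x + (v - s b) * (if x > b then 1 else 0))\<bar> \<le> \<epsilon>" if "x \<le> c" for x
      proof (cases "x > b")
        case True
        then show ?thesis using s(2)[of x] that \<open>\<And>y. b < y \<Longrightarrow> y \<le> c \<Longrightarrow> \<bar>F y - v\<bar> \<le> \<epsilon>\<close>[of x] by simp
      qed (use s(3) in auto)
      moreover have "s x + (v - s b) * (if x > b then 1 else 0) = s c + (v - s b) * (if c > b then 1 else 0)"
        if "c \<le> x" for x
      proof -
        have "b < x" using that \<open>b < c\<close> by simp
        then have "s x = s b" "s c = s b" using \<open>b < c\<close> s(2)[of x] s(2)[of c] by (simp_all add: less_imp_le)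
        then show ?thesis using \<open>b < x\<close> \<open>b < c\<close> by simp
      qed
      ultimately show "(\<forall>x\<ge>c. s x + (v - s b) * (if x > b then 1 else 0) = s c + (v - s b) * (if c > b then 1 else 0)) \<and>
         (\<forall>x\<le>c. \<bar>F x - (s x + (v - s b) * (if x > b then 1 else 0))\<bar> \<le> \<epsilon>)"
        by blast
    qed
  qed
  have "Q \<infinity>"
  proof (rule ereal_left_right_induct)
    show "Q (-\<infinity>)" unfolding Q_def using assms(1) \<open>\<epsilon> > 0\<close>
      by (intro bexI[OF _ step_functions.zero]) auto
  next
    fix x :: ereal assume "-\<infinity> < x"
    from left[OF this \<open>\<epsilon> > 0\<close>] obtain d where d: "d < x" "\<And>y. d < y \<Longrightarrow> y \<le> x \<Longrightarrow> \<bar>F y - F x\<bar> \<le> \<epsilon>"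
      by blast
    have "Q x" if "d < b" "b < x" "Q b" for b
      using that by (intro extend[of b x "F x"] d(2)) auto
    then show "\<exists>d<x. \<forall>b. d < b \<and> b < x \<and> Q b \<longrightarrow> Q x" using d(1) by blast
  next
    fix x :: ereal assume "x < \<infinity>" "Q x"
    from right[OF this(1) \<open>\<epsilon> > 0\<close>] obtain c l where c: "x < c" "\<And>y. x < y \<Longrightarrow> y \<le> c \<Longrightarrow> \<bar>F y - l\<bar> \<le> \<epsilon>"
      by blast
    show "\<exists>c>x. Q c" using c(1) extend[OF \<open>Q x\<close> c] by blast
  qed
  then obtain s where "s \<in> step_functions" "\<And>x. x \<le> \<infinity> \<Longrightarrow> \<bar>F x - s x\<bar> \<le> \<epsilon>" unfolding Q_def by blast
  then show ?thesis by auto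
qed

lemma regulated_left: "regulated F \<Longrightarrow> \<exists>l. ((\<lambda>t. F (ereal t)) \<longlongrightarrow> l) (at_left x)"
  and regulated_right: "regulated F \<Longrightarrow> \<exists>l. ((\<lambda>t. F (ereal t)) \<longlongrightarrow> l) (at_right x)"
  unfolding regulated_def by simp_all

text \<open>At real points left continuity and the right limit supply the two local hypotheses; at
  the infinite ends they come from \<open>ends_are_limits\<close>.\<close>

lemma B_r_step_approximation:
  assumes "F \<in> B_r" "\<epsilon> > 0"
  shows "\<exists>s\<in>step_functions. \<forall>x. \<bar>F x - s x\<bar> \<le> \<epsilon>"
proof (rule step_approximation)
  have reg: "regulated F" "F (-\<infinity>) = 0" "\<And>x. F (ereal x) = left_lim F x"
    using assms unfolding B_r_def by auto
  show "F (-\<infinity>) = 0" by fact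
  fix x :: ereal and \<epsilon> :: real assume e: "\<epsilon> > 0"
  show "\<exists>d<x. \<forall>y. d < y \<and> y \<le> x \<longrightarrow> \<bar>F y - F x\<bar> \<le> \<epsilon>" if "-\<infinity> < x"
  proof (cases x)
    case (real r)
    obtain l where l: "((\<lambda>t. F (ereal t)) \<longlongrightarrow> l) (at_left r)"
      using regulated_left[OF reg(1)] by blast
    have "F (ereal r) = l" using reg(3)[of r] tendsto_Lim[OF trivial_limit_at_left_real l] unfolding left_lim_def by (rule trans)
    moreover have "eventually (\<lambda>t. \<bar>F (ereal t) - l\<bar> < \<epsilon>) (at_left r)"
      using tendstoD[OF l e] by (simp add: dist_real_def)
    then obtain b where "b < r" "\<And>y. b < y \<Longrightarrow> y < r \<Longrightarrow> \<bar>F (ereal y) - l\<bar> < \<epsilon>"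
      unfolding eventually_at_left_field by blast
    ultimately have "\<bar>F y - F x\<bar> \<le> \<epsilon>" if "ereal b < y" "y \<le> x" for y
      using that real e by (cases y) (auto simp: less_eq_real_def)
    then show ?thesis using \<open>b < r\<close> real by (intro exI[of _ "ereal b"]) auto
  next
    case PInf
    have "((\<lambda>t. F (ereal t)) \<longlongrightarrow> F \<infinity>) at_top" using reg(1) unfolding regulated_def ends_are_limits_def by auto
    from tendstoD[OF this e] have "eventually (\<lambda>t. \<bar>F (ereal t) - F \<infinity>\<bar> < \<epsilon>) at_top"
      by (simp add: dist_real_def)
    then obtain b where "\<And>y. b \<le> y \<Longrightarrow> \<bar>F (ereal y) - F \<infinity>\<bar> < \<epsilon>"
      unfolding eventually_at_top_linorder by blast
    then have "\<bar>F y - F x\<bar> \<le> \<epsilon>" if "ereal b < y" "y \<le> x" for y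
      using that PInf e by (cases y) (auto simp: less_eq_real_def)
    then show ?thesis using PInf by (intro exI[of _ "ereal b"]) auto
  qed (use that in auto)
  show "\<exists>c>x. \<exists>l. \<forall>y. x < y \<and> y \<le> c \<longrightarrow> \<bar>F y - l\<bar> \<le> \<epsilon>" if "x < \<infinity>"
  proof (cases x)
    case (real r)
    obtain l where l: "((\<lambda>t. F (ereal t)) \<longlongrightarrow> l) (at_right r)"
      using regulated_right[OF reg(1)] by blast
    have "eventually (\<lambda>t. \<bar>F (ereal t) - l\<bar> < \<epsilon>) (at_right r)"
      using tendstoD[OF l e] by (simp add: dist_real_def)
    then obtain b where b: "b > r" "\<And>y. r < y \<Longrightarrow> y < b \<Longrightarrow> \<bar>F (ereal y) - l\<bar> < \<epsilon>"
      unfolding eventually_at_right_field by blast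
    \<comment> \<open>The limit controls the open interval up to \<open>b\<close>; a smaller
      \<open>c\<close> gives a piece that is closed on the right.\<close>
    obtain c where c: "r < c" "c < b" using dense b(1) by blast
    have "\<bar>F y - l\<bar> \<le> \<epsilon>" if "x < y" "y \<le> ereal c" for y
      using that real b(2) c by (cases y) (auto simp: less_eq_real_def)
    then show ?thesis using c real by (intro exI[of _ "ereal c"]) auto
  next
    case MInf
    have "((\<lambda>t. F (ereal t)) \<longlongrightarrow> F (-\<infinity>)) at_bot" using reg(1) unfolding regulated_def ends_are_limits_def by auto
    from tendstoD[OF this e] have "eventually (\<lambda>t. \<bar>F (ereal t) - F (-\<infinity>)\<bar> < \<epsilon>) at_bot"
      by (simp add: dist_real_def)
    then obtain b where "\<And>y. y \<le> b \<Longrightarrow> \<bar>F (ereal y) - F (-\<infinity>)\<bar> < \<epsilon>"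
      unfolding eventually_at_bot_linorder by blast
    then have "\<bar>F y - F (-\<infinity>)\<bar> \<le> \<epsilon>" if "x < y" "y \<le> ereal b" for y
      using that MInf e by (cases y) (auto simp: less_eq_real_def)
    then show ?thesis using MInf by (intro exI[of _ "ereal b"]) auto
  qed (use that in auto)
qed (rule assms(2))

lemma B_r_bounded:
  assumes "F \<in> B_r"
  obtains M where "\<And>x. \<bar>F x\<bar> \<le> M"
proof -
  obtain s where s: "s \<in> step_functions" "\<And>x. \<bar>F x - s x\<bar> \<le> 1"
    using B_r_step_approximation[OF assms, of 1] by auto
  obtain M where M: "\<And>x. \<bar>s x\<bar> \<le> M" using step_bounded[OF s(1)] by blast
  have "\<bar>F x\<bar> \<le> M + 1" for x using s(2)[of x] M[of x] by linarith
  then show thesis using that by blast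
qed

lemma B_r_measurable:
  assumes "F \<in> B_r"
  shows "(\<lambda>t. F (ereal t)) \<in> borel_measurable borel"
proof -
  have "\<exists>s. s \<in> step_functions \<and> (\<forall>x. \<bar>F x - s x\<bar> \<le> inverse (real (Suc k)))" for k
    using B_r_step_approximation[OF assms, of "inverse (real (Suc k))"] by auto
  then obtain s where s: "\<And>k. s k \<in> step_functions" "\<And>k x. \<bar>F x - s k x\<bar> \<le> inverse (real (Suc k))"
    by metis
  show ?thesis
  proof (rule borel_measurable_LIMSEQ_real[of _ "\<lambda>k t. s k (ereal t)"])
    show "(\<lambda>t. s k (ereal t)) \<in> borel_measurable borel" for k by (rule step_measurable[OF s(1)])
    show "(\<lambda>k. s k (ereal t)) \<longlonglongrightarrow> F (ereal t)" for t
    proof (rule LIM_zero_cancel, rule Lim_null_comparison[OF _ LIMSEQ_inverse_real_of_nat])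
      show "eventually (\<lambda>k. norm (s k (ereal t) - F (ereal t)) \<le> inverse (real (Suc k))) sequentially"
        using s(2) by (auto simp: abs_minus_commute)
    qed
  qed
qed

text \<open>\<open>sup_norm\<close> runs over real points, while the sums also evaluate functions at
  the infinite ends, where the values are limits of real ones. The bound \<open>M\<close> makes the
  supremum genuine.\<close>

lemma abs_le_sup_norm:
  assumes "\<And>x. \<bar>F x\<bar> \<le> M" "ends_are_limits F"
  shows "\<bar>F x\<bar> \<le> sup_norm F"
proof -
  have r: "\<bar>F (ereal t)\<bar> \<le> sup_norm F" for t
    unfolding sup_norm_def using assms(1) by (intro cSUP_upper bdd_aboveI[of _ M]) auto
  show ?thesis
  proof (cases x)
    case PInf
    have "((\<lambda>t. \<bar>F (ereal t)\<bar>) \<longlongrightarrow> \<bar>F \<infinity>\<bar>) at_top"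
      using assms(2) unfolding ends_are_limits_def by (intro tendsto_intros) auto
    then show ?thesis using r PInf by (auto intro: tendsto_upperbound simp: eventually_at_top_linorder)
  next
    case MInf
    have "((\<lambda>t. \<bar>F (ereal t)\<bar>) \<longlongrightarrow> \<bar>F (-\<infinity>)\<bar>) at_bot"
      using assms(2) unfolding ends_are_limits_def by (intro tendsto_intros) auto
    then show ?thesis using r MInf by (auto intro: tendsto_upperbound simp: eventually_at_bot_linorder)
  qed (use r in auto)
qed

section \<open>Summation by parts and existence of the integral\<close>

text \<open>Abel summation that moves the increments to \<open>a\<close>. There are
  \<open>Suc M\<close> tags and hence \<open>M\<close> increments between them; \<open>d 0\<close>
  will be the value at \<open>-\<infinity>\<close>.\<close>

lemma sum_by_parts:
  fixes a d :: "nat \<Rightarrow> real"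
  shows "(\<Sum>i<Suc M. a i * (d (Suc i) - d i)) =
    a M * d (Suc M) - a 0 * d 0 - (\<Sum>i<M. d (Suc i) * (a (Suc i) - a i))"
  by (induction M) (auto simp: algebra_simps)

text \<open>Neighbouring tags of a partition may coincide, whereas \<open>var_sums\<close> takes
  strict chains; repeated points contribute nothing and are dropped.\<close>

lemma var_sums_weak_chain:
  fixes z :: "nat \<Rightarrow> ereal"
  assumes "\<And>i. i < M \<Longrightarrow> z i \<le> z (Suc i)"
  shows "(\<Sum>i<M. \<bar>g (z (Suc i)) - g (z i)\<bar>) \<in> var_sums g"
proof -
  have "\<exists>y K. (\<forall>i<K. y i < y (Suc i)) \<and> y K = z M \<and>
    (\<Sum>i<M. \<bar>g (z (Suc i)) - g (z i)\<bar>) = (\<Sum>i<K. \<bar>g (y (Suc i)) - g (y i)\<bar>)"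
    using assms
  proof (induction M)
    case 0
    then show ?case by (intro exI[of _ z] exI[of _ 0]) auto
  next
    case (Suc M)
    then obtain y K where y: "\<forall>i<K. y i < y (Suc i)" "y K = z M"
     "(\<Sum>i<M. \<bar>g (z (Suc i)) - g (z i)\<bar>) = (\<Sum>i<K. \<bar>g (y (Suc i)) - g (y i)\<bar>)" by auto
    show ?case
    proof (cases "z M = z (Suc M)")
      case True
      then show ?thesis using y by (intro exI[of _ y] exI[of _ K]) auto
    next
      case False
      then have "z M < z (Suc M)" using Suc.prems[of M] by simp
      moreover have "(\<Sum>i<K. \<bar>g ((y(Suc K := z (Suc M))) (Suc i)) - g ((y(Suc K := z (Suc M))) i)\<bar>) =
        (\<Sum>i<K. \<bar>g (y (Suc i)) - g (y i)\<bar>)" by (intro sum.cong) auto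
      ultimately show ?thesis using y
        by (intro exI[of _ "y(Suc K := z (Suc M))"] exI[of _ "Suc K"]) (auto simp: less_Suc_eq)
    qed
  qed
  then show ?thesis unfolding var_sums_def by auto
qed

lemma sum_le_variation:
  fixes z :: "nat \<Rightarrow> ereal"
  assumes "g \<in> BV" "\<And>i. i < M \<Longrightarrow> z i \<le> z (Suc i)"
  shows "(\<Sum>i<M. \<bar>g (z (Suc i)) - g (z i)\<bar>) \<le> variation g"
  unfolding variation_def using assms var_sums_weak_chain[of M z g]
  by (intro cSup_upper) (auto simp: BV_def)

lemma diff_le_variation:
  assumes "g \<in> BV"
  shows "\<bar>g y - g x\<bar> \<le> variation g"
proof -
  have *: "\<bar>g y - g x\<bar> \<le> variation g" if "x \<le> y" for x y
    using sum_le_variation[OF assms, of 1 "\<lambda>i. if i = 0 then x else y"] that by auto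
  show ?thesis using *[of x y] *[of y x] by (cases "x \<le> y") (auto simp: abs_minus_commute)
qed

lemma abs_BV_le_sup_norm:
  assumes "g \<in> BV" shows "\<bar>g x\<bar> \<le> sup_norm g"
proof (rule abs_le_sup_norm)
  show "\<bar>g x\<bar> \<le> \<bar>g 0\<bar> + variation g" for x using diff_le_variation[OF assms, of x 0] by linarith
  show "ends_are_limits g" using assms unfolding BV_def by auto
qed

text \<open>Stated for a general \<open>D\<close>, so that it serves \<open>F\<close> itself, the
  error \<open>F - s\<close> and the difference of two step functions. No gauge enters.\<close>

lemma HS_sum_bound:
  assumes g: "g \<in> BV" and tp: "tagged_partition N x z" and D: "\<And>t. \<bar>D t\<bar> \<le> e" "D (-\<infinity>) = 0"
  shows "\<bar>HS_sum N x z g D\<bar> \<le> e * BV_norm g"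
proof -
  have "e \<ge> 0" using D(1)[of 0] by linarith
  obtain M where N: "N = Suc M" using tp unfolding tagged_partition_def by (cases N) auto
  \<comment> \<open>The partition point \<open>x (Suc i)\<close> lies between the two tags.\<close>
  have mono: "z i \<le> z (Suc i)" if "i < M" for i
    using tp that unfolding tagged_partition_def N
    by (meson Suc_less_eq atLeastAtMost_iff less_Suc_eq order_trans)
  have "HS_sum N x z g D = g (z M) * D (x N) - (\<Sum>i<M. D (x (Suc i)) * (g (z (Suc i)) - g (z i)))"
    unfolding HS_sum_def N using sum_by_parts[of "\<lambda>i. g (z i)" "\<lambda>i. D (x i)" M] tp D(2)
    unfolding tagged_partition_def by simp
  also have "\<bar>\<dots>\<bar> \<le> \<bar>g (z M) * D (x N)\<bar> + (\<Sum>i<M. \<bar>D (x (Suc i)) * (g (z (Suc i)) - g (z i))\<bar>)"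
    by (rule order_trans[OF abs_triangle_ineq4 add_left_mono[OF sum_abs]])
  also have "\<dots> \<le> sup_norm g * e + (\<Sum>i<M. e * \<bar>g (z (Suc i)) - g (z i)\<bar>)"
    unfolding abs_mult using D(1) abs_BV_le_sup_norm[OF g] \<open>e \<ge> 0\<close>
    by (intro add_mono mult_mono sum_mono) (auto intro: order_trans[OF abs_ge_zero])
  also have "\<dots> \<le> sup_norm g * e + e * variation g"
    unfolding sum_distrib_left[symmetric] using sum_le_variation[OF g, where M = M and z = z] mono \<open>e \<ge> 0\<close>
    by (intro add_left_mono mult_left_mono) auto
  finally show ?thesis unfolding BV_norm_def by (simp add: algebra_simps)
qed

lemma HS_sum_diff: "HS_sum N x z g F - HS_sum N x z g G = HS_sum N x z g (\<lambda>t. F t - G t)"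
  unfolding HS_sum_def by (simp add: sum_subtractf[symmetric] algebra_simps)

text \<open>The integrals \<open>A k\<close> of approximating step functions form a Cauchy sequence,
  and their limit is the integral of \<open>F\<close>.\<close>

lemma HS_integrable:
  assumes g: "g \<in> BV" and F: "F \<in> B_r"
  obtains A where "has_HS_integral g F A"
proof -
  have "\<exists>s. s \<in> step_functions \<and> (\<forall>x. \<bar>F x - s x\<bar> \<le> inverse (real (Suc k)))" for k
    using B_r_step_approximation[OF F, of "inverse (real (Suc k))"] by auto
  then obtain s where s: "\<And>k. s k \<in> step_functions" "\<And>k x. \<bar>F x - s k x\<bar> \<le> inverse (real (Suc k))"
    by metis
  obtain A where A: "\<And>k. has_HS_integral g (s k) (A k)" using step_HS_integrable[OF s(1)] by metis
  have F0: "F (-\<infinity>) = 0" using F unfolding B_r_def by simp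
  have lim0: "(\<lambda>k. inverse (real (Suc k)) * BV_norm g) \<longlonglongrightarrow> 0"
    using tendsto_mult_right[OF LIMSEQ_inverse_real_of_nat, of "BV_norm g"] by simp
  have near: "\<bar>A k - A j\<bar> \<le> (inverse (real (Suc k)) + inverse (real (Suc j))) * BV_norm g" for k j
  proof (rule has_HS_integral_bound[OF A A])
    fix N x z assume tp: "tagged_partition N x z"
    have "\<bar>s k t - s j t\<bar> \<le> inverse (real (Suc k)) + inverse (real (Suc j))" for t
      using s(2)[of t k] s(2)[of t j] by linarith
    from HS_sum_bound[OF g tp this] show "\<bar>HS_sum N x z g (s k) - HS_sum N x z g (s j)\<bar>
       \<le> (inverse (real (Suc k)) + inverse (real (Suc j))) * BV_norm g"
      unfolding HS_sum_diff using step_minus_infinity[OF s(1)] by simp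
  qed
  have "Cauchy A"
  proof (rule metric_CauchyI)
    fix e :: real assume "e > 0"
    then have "eventually (\<lambda>k. inverse (real (Suc k)) * BV_norm g < e/2) sequentially"
      using lim0 by (intro order_tendstoD) auto
    then obtain K where K: "\<And>k. k \<ge> K \<Longrightarrow> inverse (real (Suc k)) * BV_norm g < e/2"
      unfolding eventually_sequentially by blast
    have "dist (A k) (A j) < e" if "k \<ge> K" "j \<ge> K" for k j
      using near[of k j] K[OF that(1)] K[OF that(2)] by (simp add: dist_real_def distrib_right)
    then show "\<exists>M. \<forall>m\<ge>M. \<forall>n\<ge>M. dist (A m) (A n) < e" by blast
  qed
  then obtain B where B: "A \<longlonglongrightarrow> B" using Cauchy_convergent_iff convergent_def by blast
  have "has_HS_integral g F B"
    unfolding has_HS_integral_iff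
  proof (intro allI impI)
    fix \<epsilon> :: real assume "\<epsilon> > 0"
    then have "eventually (\<lambda>k. inverse (real (Suc k)) * BV_norm g < \<epsilon>/3) sequentially"
      using lim0 by (intro order_tendstoD) auto
    moreover have "eventually (\<lambda>k. \<bar>A k - B\<bar> < \<epsilon>/3) sequentially"
      using tendstoD[OF B, of "\<epsilon>/3"] \<open>\<epsilon> > 0\<close> by (simp add: dist_real_def)
    ultimately have "eventually (\<lambda>k. inverse (real (Suc k)) * BV_norm g < \<epsilon>/3 \<and> \<bar>A k - B\<bar> < \<epsilon>/3) sequentially"
      by (rule eventually_conj)
    then obtain k where k: "inverse (real (Suc k)) * BV_norm g < \<epsilon>/3" "\<bar>A k - B\<bar> < \<epsilon>/3"
      unfolding eventually_sequentially by blast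
    have "\<epsilon>/3 > 0" using \<open>\<epsilon> > 0\<close> by simp
    \<comment> \<open>The gauge comes from the step function alone; the distance of its sums from
      those of \<open>F\<close> is bounded on all partitions.\<close>
    from has_HS_integralD[OF A[of k] this] obtain \<gamma> where \<gamma>: "ereal_gauge \<gamma>"
      "\<And>N x z. fine_partition \<gamma> N x z \<Longrightarrow> \<bar>HS_sum N x z g (s k) - A k\<bar> < \<epsilon>/3" by blast
    have "\<bar>HS_sum N x z g F - B\<bar> < \<epsilon>" if fine: "fine_partition \<gamma> N x z" for N x z
    proof -
      have tp: "tagged_partition N x z" using fine unfolding fine_partition_def by blast
      have "\<bar>HS_sum N x z g F - HS_sum N x z g (s k)\<bar> \<le> inverse (real (Suc k)) * BV_norm g"
        unfolding HS_sum_diff using s F0 step_minus_infinity[OF s(1)]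
        by (intro HS_sum_bound[OF g tp]) auto
      then show ?thesis using k \<gamma>(2)[OF fine] by linarith
    qed
    then show "\<exists>\<gamma>. ereal_gauge \<gamma> \<and>
        (\<forall>N x z. fine_partition \<gamma> N x z \<longrightarrow> \<bar>HS_sum N x z g F - B\<bar> < \<epsilon>)"
      using \<gamma>(1) by blast
  qed
  then show thesis by (rule that)
qed

lemma abs_B_r_le_sup_norm: "F \<in> B_r \<Longrightarrow> \<bar>F x\<bar> \<le> sup_norm F"
  using B_r_bounded[of F] abs_le_sup_norm[of F] unfolding B_r_def regulated_def by blast

lemma HS_integral_bound:
  assumes g: "g \<in> BV" and F: "F \<in> B_r"
  shows "\<bar>HS_integral g F\<bar> \<le> sup_norm F * BV_norm g"
proof -
  obtain A where A: "has_HS_integral g F A" using HS_integrable[OF assms] by blast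
  have "\<bar>A - 0\<bar> \<le> sup_norm F * BV_norm g"
  proof (rule has_HS_integral_bound[OF A has_HS_integral_zero])
    fix N x z assume "tagged_partition N x z"
    then have "\<bar>HS_sum N x z g F\<bar> \<le> sup_norm F * BV_norm g"
      using F by (intro HS_sum_bound[OF g _ abs_B_r_le_sup_norm[OF F]]) (auto simp: B_r_def)
    then show "\<bar>HS_sum N x z g F - HS_sum N x z g (\<lambda>_. 0)\<bar> \<le> sup_norm F * BV_norm g"
      by (simp add: HS_sum_def)
  qed
  then show ?thesis using HS_integral_eq[OF A] by simp
qed

section \<open>Functions of bounded variation\<close>

text \<open>The variation of \<open>g\<close> up to \<open>x\<close>. Weak chains let
  \<open>x\<close> be appended without asking whether it repeats the last point.\<close>

definition lower_variation :: "(ereal \<Rightarrow> real) \<Rightarrow> ereal \<Rightarrow> real" where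
  "lower_variation g x = Sup {\<Sum>i<N. \<bar>g (z (Suc i)) - g (z i)\<bar> | (z :: nat \<Rightarrow> ereal) N.
     (\<forall>i<N. z i \<le> z (Suc i)) \<and> z N \<le> x}"

text \<open>This one inequality makes both \<open>lower_variation g\<close> and its difference with
  \<open>g\<close> increasing, which is the Jordan decomposition.\<close>

lemma lower_variation_jump:
  assumes g: "g \<in> BV" and "x \<le> y"
  shows "lower_variation g x + \<bar>g y - g x\<bar> \<le> lower_variation g y"
proof -
  let ?S = "\<lambda>x. {\<Sum>i<N. \<bar>g (z (Suc i)) - g (z i)\<bar> | (z :: nat \<Rightarrow> ereal) N.
     (\<forall>i<N. z i \<le> z (Suc i)) \<and> z N \<le> x}"
  have bdd: "bdd_above (?S y)"
    using sum_le_variation[OF g] by (intro bdd_aboveI[of _ "variation g"]) auto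
  have "s \<le> lower_variation g y - \<bar>g y - g x\<bar>" if "s \<in> ?S x" for s
  proof -
    obtain z N where z: "s = (\<Sum>i<N. \<bar>g (z (Suc i)) - g (z i)\<bar>)" "\<forall>i<N. z i \<le> z (Suc i)" "z N \<le> x"
      using \<open>s \<in> ?S x\<close> by blast
    \<comment> \<open>Append \<open>x\<close>, then \<open>y\<close>; the increment from
      \<open>z N\<close> to \<open>x\<close> is nonnegative and gets discarded.\<close>
    define w where "w = z(Suc N := x, Suc (Suc N) := y)"
    have "(\<Sum>i<N. \<bar>g (w (Suc i)) - g (w i)\<bar>) = s" unfolding z(1) w_def by (intro sum.cong) auto
    then have "(\<Sum>i<Suc (Suc N). \<bar>g (w (Suc i)) - g (w i)\<bar>) = s + \<bar>g x - g (z N)\<bar> + \<bar>g y - g x\<bar>"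
      by (simp add: w_def)
    moreover have "(\<Sum>i<Suc (Suc N). \<bar>g (w (Suc i)) - g (w i)\<bar>) \<in> ?S y"
      using z(2,3) \<open>x \<le> y\<close> unfolding mem_Collect_eq
      by (intro exI[of _ w] exI[of _ "Suc (Suc N)"]) (auto simp: w_def less_Suc_eq)
    then have "(\<Sum>i<Suc (Suc N). \<bar>g (w (Suc i)) - g (w i)\<bar>) \<le> lower_variation g y"
      unfolding lower_variation_def by (intro cSup_upper bdd)
    ultimately show ?thesis by linarith
  qed
  moreover have "?S x \<noteq> {}" by (auto intro!: exI[of _ "\<lambda>_. x"] exI[of _ 0])
  ultimately have "lower_variation g x \<le> lower_variation g y - \<bar>g y - g x\<bar>"
    unfolding lower_variation_def[of g x] by (intro cSup_least) auto
  then show ?thesis by simp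
qed

text \<open>Source of one-sided limits, measurability and countability of the discontinuities, each
  inherited from monotone functions.\<close>

lemma jordan_decomposition:
  assumes "g \<in> BV"
  obtains p q :: "real \<Rightarrow> real" where "mono p" "mono q" "\<And>t. g (ereal t) = p t - q t"
proof
  show "mono (\<lambda>t. lower_variation g (ereal t))"
    using lower_variation_jump[OF assms] by (intro monoI) (smt (verit) ereal_less_eq(3))
  show "mono (\<lambda>t. lower_variation g (ereal t) - g (ereal t))"
    using lower_variation_jump[OF assms] by (intro monoI) (smt (verit) ereal_less_eq(3))
qed simp

lemma mono_tendsto_at_left:
  fixes f :: "real \<Rightarrow> real"
  assumes "mono f"
  shows "\<exists>l. (f \<longlongrightarrow> l) (at_left x)"
proof (intro exI order_tendstoI)
  have bdd: "bdd_above (f ` {..<x})"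
    using monoD[OF assms] by (intro bdd_aboveI[of _ "f x"]) (auto intro: less_imp_le)
  fix a assume "a < Sup (f ` {..<x})"
  then obtain y where y: "y < x" "a < f y" using less_cSup_iff[OF _ bdd] by auto
  show "eventually (\<lambda>t. a < f t) (at_left x)"
    unfolding eventually_at_left_field
    using y monoD[OF assms, of y] by (intro exI[of _ y]) (auto intro: less_le_trans less_imp_le)
next
  have bdd: "bdd_above (f ` {..<x})"
    using monoD[OF assms] by (intro bdd_aboveI[of _ "f x"]) (auto intro: less_imp_le)
  fix a assume "Sup (f ` {..<x}) < a"
  then have "f t < a" if "t < x" for t
    using cSup_upper[OF _ bdd, of "f t"] that by auto
  then show "eventually (\<lambda>t. f t < a) (at_left x)"
    unfolding eventually_at_left_field by (intro exI[of _ "x - 1"]) auto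
qed

lemma mono_tendsto_at_right:
  fixes f :: "real \<Rightarrow> real"
  assumes "mono f"
  shows "\<exists>l. (f \<longlongrightarrow> l) (at_right x)"
proof -
  have "mono (\<lambda>t. - f (- t))" using assms by (simp add: mono_def)
  then obtain l where "((\<lambda>t. - f (- t)) \<longlongrightarrow> l) (at_left (- x))" using mono_tendsto_at_left by blast
  from tendsto_minus[OF this] have "((\<lambda>t. f (- t)) \<longlongrightarrow> - l) (at_left (- x))" by simp
  then have "(f \<longlongrightarrow> - l) (at_right x)" unfolding filterlim_at_left_to_right by simp
  then show ?thesis by blast
qed

lemma BV_regulated:
  assumes "g \<in> BV"
  shows "regulated g"
proof -
  obtain p q :: "real \<Rightarrow> real" where pq: "mono p" "mono q" "\<And>t. g (ereal t) = p t - q t"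
    by (rule jordan_decomposition[OF assms]) blast
  have "\<exists>l. ((\<lambda>t. p t - q t) \<longlongrightarrow> l) (at_left x)" for x
    using mono_tendsto_at_left[OF pq(1), of x] mono_tendsto_at_left[OF pq(2), of x]
    by (blast intro: tendsto_diff)
  moreover have "\<exists>l. ((\<lambda>t. p t - q t) \<longlongrightarrow> l) (at_right x)" for x
    using mono_tendsto_at_right[OF pq(1), of x] mono_tendsto_at_right[OF pq(2), of x]
    by (blast intro: tendsto_diff)
  ultimately show ?thesis using assms unfolding regulated_def BV_def pq(3) by simp
qed

lemma BV_measurable:
  assumes "g \<in> BV"
  shows "(\<lambda>t. g (ereal t)) \<in> borel_measurable borel"
proof -
  obtain p q :: "real \<Rightarrow> real" where pq: "mono p" "mono q" "\<And>t. g (ereal t) = p t - q t"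
    by (rule jordan_decomposition[OF assms]) blast
  show ?thesis unfolding pq(3)
    by (intro borel_measurable_diff borel_measurable_mono pq)
qed

lemma BV_countable_discontinuities:
  assumes "g \<in> BV"
  shows "countable {t. \<not> isCont (\<lambda>t. g (ereal t)) t}"
proof -
  obtain p q :: "real \<Rightarrow> real" where pq: "mono p" "mono q" "\<And>t. g (ereal t) = p t - q t"
    by (rule jordan_decomposition[OF assms]) blast
  have "{t. \<not> isCont (\<lambda>t. g (ereal t)) t} \<subseteq> {t. \<not> isCont p t} \<union> {t. \<not> isCont q t}"
    unfolding pq(3) by (auto intro: continuous_diff)
  moreover have "countable ({t. \<not> isCont p t} \<union> {t. \<not> isCont q t})"
    using mono_ctble_discont[OF pq(1)] mono_ctble_discont[OF pq(2)] by blast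
  ultimately show ?thesis by (rule countable_subset)
qed

lemma tendsto_left_lim: "regulated g \<Longrightarrow> ((\<lambda>t. g (ereal t)) \<longlongrightarrow> left_lim g x) (at_left x)"
  unfolding left_lim_def using regulated_left[of g x] tendsto_Lim[OF trivial_limit_at_left_real]
  by metis

lemma tendsto_right_lim: "regulated g \<Longrightarrow> ((\<lambda>t. g (ereal t)) \<longlongrightarrow> right_lim g x) (at_right x)"
  unfolding right_lim_def using regulated_right[of g x] tendsto_Lim[OF trivial_limit_at_right_real]
  by metis

lemma left_lim_eqI: "((\<lambda>t. g (ereal t)) \<longlongrightarrow> l) (at_left x) \<Longrightarrow> left_lim g x = l"
  unfolding left_lim_def by (rule tendsto_Lim) auto

lemma right_lim_eqI: "((\<lambda>t. g (ereal t)) \<longlongrightarrow> l) (at_right x) \<Longrightarrow> right_lim g x = l"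
  unfolding right_lim_def by (rule tendsto_Lim) auto

section \<open>Normalisation at the discontinuities\<close>

text \<open>The values at the ends are kept: \<open>NBV\<close> prescribes averages at real points
  only, and in \<open>BV\<close> the ends are already limits.\<close>

definition normalise :: "real \<Rightarrow> (ereal \<Rightarrow> real) \<Rightarrow> ereal \<Rightarrow> real" where
  "normalise lam g x = (case x of ereal r \<Rightarrow> (1 - lam) * left_lim g r + lam * right_lim g r
     | PInfty \<Rightarrow> g \<infinity> | MInfty \<Rightarrow> g (-\<infinity>))"

lemma normalise_simps [simp]:
  "normalise lam g (ereal r) = (1 - lam) * left_lim g r + lam * right_lim g r"
  "normalise lam g \<infinity> = g \<infinity>" "normalise lam g (-\<infinity>) = g (-\<infinity>)"
  by (simp_all add: normalise_def)

text \<open>Shifting by \<open>\<delta>\<close> is increasing on the extended line and fixes \<open>\<plusminus>\<infinity>\<close>, so both the supremum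
  norm and the variation of these averages are bounded by those of \<open>g\<close>.\<close>

lemma tendsto_normalise:
  assumes "regulated g"
  shows "((\<lambda>\<delta>. (1 - lam) * g (x - ereal \<delta>) + lam * g (x + ereal \<delta>)) \<longlongrightarrow> normalise lam g x) (at_right 0)"
proof (cases x)
  case (real r)
  have "filterlim (\<lambda>\<delta>. r - \<delta>) (at_left r) (at_right 0)"
    unfolding filterlim_at by (auto intro!: tendsto_eq_intros eventually_at_rightI[of 0 1])
  from filterlim_compose[OF tendsto_left_lim[OF assms] this]
  have l: "((\<lambda>\<delta>. g (ereal (r - \<delta>))) \<longlongrightarrow> left_lim g r) (at_right 0)" .
  have "filterlim (\<lambda>\<delta>. r + \<delta>) (at_right r) (at_right 0)"
    unfolding filterlim_at by (auto intro!: tendsto_eq_intros eventually_at_rightI[of 0 1])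
  from filterlim_compose[OF tendsto_right_lim[OF assms] this]
  have "((\<lambda>\<delta>. g (ereal (r + \<delta>))) \<longlongrightarrow> right_lim g r) (at_right 0)" .
  with l show ?thesis unfolding real by (auto intro!: tendsto_intros)
qed (auto simp: algebra_simps)

lemma abs_convex_combination_le:
  fixes a b e lam :: real
  assumes "0 \<le> lam" "lam \<le> 1" "\<bar>a\<bar> \<le> e" "\<bar>b\<bar> \<le> e"
  shows "\<bar>(1 - lam) * a + lam * b\<bar> \<le> e"
proof -
  have "\<bar>(1 - lam) * a + lam * b\<bar> \<le> (1 - lam) * \<bar>a\<bar> + lam * \<bar>b\<bar>"
    using assms abs_triangle_ineq[of "(1 - lam) * a" "lam * b"] by (simp add: abs_mult)
  also have "\<dots> \<le> (1 - lam) * e + lam * e" using assms by (intro add_mono mult_left_mono) auto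
  finally show ?thesis by (simp add: algebra_simps)
qed

text \<open>The points \<open>z i - \<delta>\<close> and the points \<open>z i + \<delta>\<close>
  again form weak chains, so a convex combination of two variation sums bounds the sum for the
  average; then \<open>\<delta>\<close> tends to \<open>0\<close>.\<close>

lemma normalise_variation_sum_le:
  assumes g: "g \<in> BV" and lam: "0 \<le> lam" "lam \<le> 1" and z: "\<And>i. i < N \<Longrightarrow> z i \<le> z (Suc i)"
  shows "(\<Sum>i<N. \<bar>normalise lam g (z (Suc i)) - normalise lam g (z i)\<bar>) \<le> variation g"
proof (rule tendsto_upperbound)
  let ?A = "\<lambda>\<delta> x. (1 - lam) * g (x - ereal \<delta>) + lam * g (x + ereal \<delta>)"
  show "((\<lambda>\<delta>. \<Sum>i<N. \<bar>?A \<delta> (z (Suc i)) - ?A \<delta> (z i)\<bar>) \<longlongrightarrow>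
     (\<Sum>i<N. \<bar>normalise lam g (z (Suc i)) - normalise lam g (z i)\<bar>)) (at_right 0)"
    by (intro tendsto_sum tendsto_rabs tendsto_diff tendsto_normalise BV_regulated g)
  have "(\<Sum>i<N. \<bar>?A \<delta> (z (Suc i)) - ?A \<delta> (z i)\<bar>) \<le> variation g" for \<delta>
  proof -
    have "(\<Sum>i<N. \<bar>?A \<delta> (z (Suc i)) - ?A \<delta> (z i)\<bar>) \<le>
      (\<Sum>i<N. (1 - lam) * \<bar>g (z (Suc i) - ereal \<delta>) - g (z i - ereal \<delta>)\<bar>
            + lam * \<bar>g (z (Suc i) + ereal \<delta>) - g (z i + ereal \<delta>)\<bar>)"
    proof (rule sum_mono)
      fix i
      have "?A \<delta> (z (Suc i)) - ?A \<delta> (z i) = (1 - lam) * (g (z (Suc i) - ereal \<delta>) - g (z i - ereal \<delta>))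
            + lam * (g (z (Suc i) + ereal \<delta>) - g (z i + ereal \<delta>))" by (simp add: algebra_simps)
      then show "\<bar>?A \<delta> (z (Suc i)) - ?A \<delta> (z i)\<bar> \<le> (1 - lam) * \<bar>g (z (Suc i) - ereal \<delta>) - g (z i - ereal \<delta>)\<bar>
            + lam * \<bar>g (z (Suc i) + ereal \<delta>) - g (z i + ereal \<delta>)\<bar>"
        using lam abs_triangle_ineq[of "(1 - lam) * (g (z (Suc i) - ereal \<delta>) - g (z i - ereal \<delta>))"
          "lam * (g (z (Suc i) + ereal \<delta>) - g (z i + ereal \<delta>))"] by (simp add: abs_mult)
    qed
    also have "\<dots> = (1 - lam) * (\<Sum>i<N. \<bar>g (z (Suc i) - ereal \<delta>) - g (z i - ereal \<delta>)\<bar>)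
            + lam * (\<Sum>i<N. \<bar>g (z (Suc i) + ereal \<delta>) - g (z i + ereal \<delta>)\<bar>)"
      by (simp add: sum.distrib sum_distrib_left)
    also have "\<dots> \<le> (1 - lam) * variation g + lam * variation g"
      using lam z
      by (intro add_mono mult_left_mono sum_le_variation[OF g, of N "\<lambda>i. z i - ereal \<delta>"]
          sum_le_variation[OF g, of N "\<lambda>i. z i + ereal \<delta>"]) (auto intro: ereal_minus_mono add_right_mono)
    finally show ?thesis by (simp add: algebra_simps)
  qed
  then show "eventually (\<lambda>\<delta>. (\<Sum>i<N. \<bar>?A \<delta> (z (Suc i)) - ?A \<delta> (z i)\<bar>) \<le> variation g) (at_right 0)"
    by simp
qed simp

text \<open>A closed bound on an open interval around \<open>t\<close> passes to the averages over
  \<open>t - \<delta>\<close> and \<open>t + \<delta>\<close> and so to their limit. It yields the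
  limits of the normalisation and, with \<open>l = 0\<close>, its supremum bound.\<close>

lemma normalise_near:
  assumes g: "regulated g" and lam: "0 \<le> lam" "lam \<le> 1"
    and near: "\<And>t. a < t \<Longrightarrow> t < b \<Longrightarrow> \<bar>g (ereal t) - l\<bar> \<le> e" and t: "a < t" "t < b"
  shows "\<bar>normalise lam g (ereal t) - l\<bar> \<le> e"
proof (rule tendsto_upperbound)
  let ?A = "\<lambda>\<delta>. (1 - lam) * g (ereal t - ereal \<delta>) + lam * g (ereal t + ereal \<delta>)"
  show "((\<lambda>\<delta>. \<bar>?A \<delta> - l\<bar>) \<longlongrightarrow> \<bar>normalise lam g (ereal t) - l\<bar>) (at_right 0)"
    by (intro tendsto_rabs tendsto_diff tendsto_normalise g tendsto_const)
  have "\<bar>?A \<delta> - l\<bar> \<le> e" if "0 < \<delta>" "\<delta> < min (t - a) (b - t)" for \<delta>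
  proof -
    have "\<bar>(1 - lam) * (g (ereal (t - \<delta>)) - l) + lam * (g (ereal (t + \<delta>)) - l)\<bar> \<le> e"
      using that t by (intro abs_convex_combination_le lam near) auto
    then show ?thesis by (simp add: algebra_simps)
  qed
  then show "eventually (\<lambda>\<delta>. \<bar>?A \<delta> - l\<bar> \<le> e) (at_right 0)"
    using t by (intro eventually_at_rightI[of 0 "min (t - a) (b - t)"]) auto
qed simp

lemma normalise_limits:
  assumes g: "regulated g" and lam: "0 \<le> lam" "lam \<le> 1"
  shows "((\<lambda>t. g (ereal t)) \<longlongrightarrow> l) (at_left x) \<Longrightarrow> ((\<lambda>t. normalise lam g (ereal t)) \<longlongrightarrow> l) (at_left x)"
    and "((\<lambda>t. g (ereal t)) \<longlongrightarrow> l) (at_right x) \<Longrightarrow> ((\<lambda>t. normalise lam g (ereal t)) \<longlongrightarrow> l) (at_right x)"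
    and "((\<lambda>t. g (ereal t)) \<longlongrightarrow> l) at_top \<Longrightarrow> ((\<lambda>t. normalise lam g (ereal t)) \<longlongrightarrow> l) at_top"
    and "((\<lambda>t. g (ereal t)) \<longlongrightarrow> l) at_bot \<Longrightarrow> ((\<lambda>t. normalise lam g (ereal t)) \<longlongrightarrow> l) at_bot"
proof -
  have lim: "((\<lambda>t. normalise lam g (ereal t)) \<longlongrightarrow> l) F"
    if g_lim: "((\<lambda>t. g (ereal t)) \<longlongrightarrow> l) F"
    \<comment> \<open>The value of \<open>normalise lam g\<close> at \<open>t\<close> depends on
      \<open>g\<close> on both sides of \<open>t\<close>, so \<open>P\<close> has to hold on a whole
      interval around \<open>t\<close>. The four filters share this property.\<close>
    and F: "\<And>P. eventually P F \<Longrightarrow> eventually (\<lambda>t. \<exists>a b. a < t \<and> t < b \<and> (\<forall>s. a < s \<and> s < b \<longrightarrow> P s)) F"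
    for F :: "real filter"
  proof (rule tendstoI)
    fix e :: real assume "e > 0"
    then have "e/2 > 0" by simp
    from tendstoD[OF g_lim this] have "eventually (\<lambda>t. \<bar>g (ereal t) - l\<bar> \<le> e/2) F"
      by (auto simp: dist_real_def elim: eventually_mono)
    from F[OF this] show "eventually (\<lambda>t. dist (normalise lam g (ereal t)) l < e) F"
    proof (rule eventually_mono)
      fix t assume "\<exists>a b. a < t \<and> t < b \<and> (\<forall>s. a < s \<and> s < b \<longrightarrow> \<bar>g (ereal s) - l\<bar> \<le> e/2)"
      then obtain a b where "a < t" "t < b" "\<And>s. a < s \<Longrightarrow> s < b \<Longrightarrow> \<bar>g (ereal s) - l\<bar> \<le> e/2" by blast
      then have "\<bar>normalise lam g (ereal t) - l\<bar> \<le> e/2" by (intro normalise_near[OF g lam])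
      then show "dist (normalise lam g (ereal t)) l < e" using \<open>e > 0\<close> by (simp add: dist_real_def)
    qed
  qed
  show "((\<lambda>t. g (ereal t)) \<longlongrightarrow> l) (at_left x) \<Longrightarrow> ((\<lambda>t. normalise lam g (ereal t)) \<longlongrightarrow> l) (at_left x)"
    by (rule lim, assumption, unfold eventually_at_left_field) blast
  show "((\<lambda>t. g (ereal t)) \<longlongrightarrow> l) (at_right x) \<Longrightarrow> ((\<lambda>t. normalise lam g (ereal t)) \<longlongrightarrow> l) (at_right x)"
    by (rule lim, assumption, unfold eventually_at_right_field) blast
  show "((\<lambda>t. g (ereal t)) \<longlongrightarrow> l) at_top \<Longrightarrow> ((\<lambda>t. normalise lam g (ereal t)) \<longlongrightarrow> l) at_top"
    by (rule lim, assumption, unfold eventually_at_top_dense) (meson less_trans gt_ex)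
  show "((\<lambda>t. g (ereal t)) \<longlongrightarrow> l) at_bot \<Longrightarrow> ((\<lambda>t. normalise lam g (ereal t)) \<longlongrightarrow> l) at_bot"
    by (rule lim, assumption, unfold eventually_at_bot_dense) (meson less_trans lt_ex)
qed

text \<open>Normalising leaves the one-sided limits unchanged, so the averages demanded by
  \<open>NBV\<close> are those that define \<open>normalise\<close>.\<close>

lemma normalise_NBV:
  assumes g: "g \<in> BV" and lam: "0 \<le> lam" "lam \<le> 1"
  shows "normalise lam g \<in> NBV lam"
proof -
  note reg = BV_regulated[OF g]
  note lims = normalise_limits[OF reg lam]
  have "bdd_above (var_sums (normalise lam g))"
    using normalise_variation_sum_le[OF g lam]
    by (intro bdd_aboveI[of _ "variation g"]) (auto simp: var_sums_def less_imp_le)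
  moreover have "ends_are_limits (normalise lam g)"
    using reg lims(3,4) unfolding ends_are_limits_def regulated_def by simp
  moreover have "left_lim (normalise lam g) x = left_lim g x" for x
    by (rule left_lim_eqI lims(1) tendsto_left_lim[OF reg])+
  moreover have "right_lim (normalise lam g) x = right_lim g x" for x
    by (rule right_lim_eqI lims(2) tendsto_right_lim[OF reg])+
  ultimately show ?thesis unfolding NBV_def BV_def by simp
qed

lemma BV_norm_normalise_le:
  assumes g: "g \<in> BV" and lam: "0 \<le> lam" "lam \<le> 1"
  shows "BV_norm (normalise lam g) \<le> BV_norm g"
  unfolding BV_norm_def
proof (rule add_mono)
  show "variation (normalise lam g) \<le> variation g"
    unfolding variation_def[of "normalise lam g"]
    using normalise_variation_sum_le[OF g lam] var_sums_weak_chain[of 0]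
    by (intro cSup_least) (auto simp: var_sums_def less_imp_le)
  have "\<bar>normalise lam g (ereal t)\<bar> \<le> sup_norm g" for t
    using normalise_near[OF BV_regulated[OF g] lam, of "t - 1" "t + 1" 0 "sup_norm g" t]
      abs_BV_le_sup_norm[OF g] by simp
  then show "sup_norm (normalise lam g) \<le> sup_norm g"
    unfolding sup_norm_def[of "normalise lam g"] by (intro cSUP_least) auto
qed

lemma normalise_eq_at_continuity:
  assumes "isCont (\<lambda>t. g (ereal t)) t"
  shows "normalise lam g (ereal t) = g (ereal t)"
proof -
  have "((\<lambda>t. g (ereal t)) \<longlongrightarrow> g (ereal t)) (at_left t)" "((\<lambda>t. g (ereal t)) \<longlongrightarrow> g (ereal t)) (at_right t)"
    using assms unfolding isCont_def filterlim_at_split by simp_all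
  then have "left_lim g t = g (ereal t)" "right_lim g t = g (ereal t)"
    by (simp_all add: left_lim_eqI right_lim_eqI)
  then show ?thesis by (simp add: algebra_simps)
qed

text \<open>One-sided limits fix the values at real points through the averages, and the values at
  the ends follow as limits.\<close>

lemma NBV_eqI:
  assumes "g \<in> NBV lam" "k \<in> NBV lam"
    and left: "\<And>x. left_lim g x = left_lim k x" and right: "\<And>x. right_lim g x = right_lim k x"
  shows "g = k"
proof
  fix x :: ereal
  have r: "g (ereal t) = k (ereal t)" for t using assms unfolding NBV_def by simp
  have ends: "ends_are_limits g" "ends_are_limits k" using assms unfolding NBV_def BV_def by auto
  have lims: "((\<lambda>t. g (ereal t)) \<longlongrightarrow> g \<infinity>) at_top" "((\<lambda>t. g (ereal t)) \<longlongrightarrow> g (-\<infinity>)) at_bot"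
    "((\<lambda>t. g (ereal t)) \<longlongrightarrow> k \<infinity>) at_top" "((\<lambda>t. g (ereal t)) \<longlongrightarrow> k (-\<infinity>)) at_bot"
    using ends unfolding ends_are_limits_def r by blast+
  have "g \<infinity> = k \<infinity>" using tendsto_unique[OF _ lims(1,3)] by simp
  moreover have "g (-\<infinity>) = k (-\<infinity>)" using tendsto_unique[OF _ lims(2,4)] by simp
  ultimately show "g x = k x" using r by (cases x) auto
qed

section \<open>Iterated integrals\<close>

text \<open>Guards against the default value \<open>0\<close> of the Lebesgue integral of a
  non-integrable function, with which additivity could fail.\<close>

definition locally_integrable :: "(real \<Rightarrow> real) \<Rightarrow> bool" where
  "locally_integrable u \<longleftrightarrow> (\<forall>a b. set_integrable lborel {a..b} u)"

lemma locally_integrable_interval: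
  assumes "locally_integrable u"
  shows "interval_lebesgue_integrable lborel (ereal a) (ereal b) u"
proof -
  have "set_integrable lborel {a<..<b} u" for a b
    using assms unfolding locally_integrable_def
    by (intro set_integrable_subset[of lborel "{a..b}" u "{a<..<b}"]) auto
  then show ?thesis unfolding interval_lebesgue_integrable_def by simp
qed

lemma locally_integrable_bounded:
  fixes u :: "real \<Rightarrow> real"
  assumes "u \<in> borel_measurable borel" "\<And>x. \<bar>u x\<bar> \<le> M"
  shows "locally_integrable u"
  unfolding locally_integrable_def set_integrable_def
proof (intro allI)
  fix a b :: real
  show "integrable lborel (\<lambda>x. indicator {a..b} x *\<^sub>R u x)"
  proof (rule Bochner_Integration.integrable_bound)
    show "integrable lborel (\<lambda>x. indicator {a..b} x *\<^sub>R M)"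
      using borel_integrable_atLeastAtMost'[of a b "\<lambda>_. M"] unfolding set_integrable_def by simp
    show "(\<lambda>x. indicator {a..b} x *\<^sub>R u x) \<in> borel_measurable lborel" using assms(1) by simp
    show "AE x in lborel. norm (indicator {a..b} x *\<^sub>R u x) \<le> norm (indicator {a..b} x *\<^sub>R M)"
      using order_trans[OF assms(2) abs_ge_self] by (intro AE_I2) (auto simp: indicator_def)
  qed
qed

lemma locally_integrable_continuous:
  assumes "continuous_on UNIV u"
  shows "locally_integrable u"
  unfolding locally_integrable_def
  by (intro allI borel_integrable_atLeastAtMost' continuous_on_subset[OF assms] subset_UNIV)

lemma interval_integral_difference:
  assumes "locally_integrable u"
  shows "(LBINT t=ereal a..ereal b. u t) = (LBINT t=0..ereal b. u t) - (LBINT t=0..ereal a. u t)"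
proof -
  have "(LBINT t=ereal 0..ereal a. u t) + (LBINT t=ereal a..ereal b. u t) = (LBINT t=ereal 0..ereal b. u t)"
    \<comment> \<open>The rule asks for integrability from the least to the greatest of
      \<open>0\<close>, \<open>a\<close>, \<open>b\<close>, in whatever order they stand; both are
      real.\<close>
    by (rule interval_integral_sum)
      (simp add: locally_integrable_interval[OF assms] flip: ereal_min ereal_max)
  then show ?thesis by (simp add: zero_ereal_def)
qed

text \<open>Moving the base point from \<open>0\<close> to \<open>a\<close> leaves an ordinary
  indefinite integral on \<open>{a..b}\<close>; bounded open intervals exhaust the line.\<close>

lemma continuous_indefinite_integral:
  assumes "locally_integrable u"
  shows "continuous_on UNIV (\<lambda>x. LBINT t=0..ereal x. u t)"
proof -
  have "continuous_on {a<..<b} (\<lambda>x. LBINT t=0..ereal x. u t)" for a b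
  proof -
    have int: "set_integrable lborel {a..x} u" for x
      using assms unfolding locally_integrable_def by blast
    have eq: "integral {a..x} u + (LBINT t=0..ereal a. u t) = (LBINT t=0..ereal x. u t)" if "a \<le> x" for x
      using interval_integral_difference[OF assms, of a x] interval_integral_eq_integral[OF that int] by simp
    have "continuous_on {a..b} (\<lambda>x. integral {a..x} u + (LBINT t=0..ereal a. u t))"
      using set_borel_integral_eq_integral(1)[OF int]
      by (intro continuous_intros indefinite_integral_continuous_1)
    then have "continuous_on {a..b} (\<lambda>x. LBINT t=0..ereal x. u t)"
      by (rule continuous_on_eq) (use eq in auto)
    then show ?thesis by (rule continuous_on_subset) auto
  qed
  then have "continuous_on (\<Union>n::nat. {- real n<..<real n}) (\<lambda>x. LBINT t=0..ereal x. u t)"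
    by (intro continuous_on_open_UN) auto
  moreover have "(\<Union>n::nat. {- real n<..<real n}) = UNIV"
  proof -
    have "\<exists>n::nat. - real n < x \<and> x < real n" for x
    proof -
      obtain n where "\<bar>x\<bar> < real n" using reals_Archimedean2 by blast
      then show ?thesis by (intro exI[of _ n]) linarith
    qed
    then show ?thesis by auto
  qed
  ultimately show ?thesis by simp
qed

text \<open>If \<open>l > k\<close>, then \<open>u - v\<close> exceeds \<open>(l - k) / 2\<close> on
  an interval next to \<open>x\<close>, and its integral there would be positive instead of zero.
  Thus an indefinite integral determines the one-sided limits of its integrand wherever they
  exist.\<close>

lemma limit_le_of_equal_integrals:
  fixes u v :: "real \<Rightarrow> real"
  assumes u: "locally_integrable u" and v: "locally_integrable v"
    and eq: "\<And>x. (LBINT t=0..ereal x. u t) = (LBINT t=0..ereal x. v t)"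
    and lim: "(u \<longlongrightarrow> l) F" "(v \<longlongrightarrow> k) F" and F: "F = at_left x \<or> F = at_right x"
  shows "l \<le> k"
proof (rule ccontr)
  assume "\<not> l \<le> k"
  then have "l - k > (l - k) / 2" by simp
  with tendsto_diff[OF lim] have "eventually (\<lambda>t. u t - v t > (l - k) / 2) F"
    by (rule order_tendstoD)
  then have "\<exists>a b. a < b \<and> (\<forall>t. a < t \<and> t < b \<longrightarrow> u t - v t > (l - k) / 2)"
    using F by (elim disjE) (simp_all only: eventually_at_left_field eventually_at_right_field; blast)+
  then obtain a b where ab: "a < b" "\<And>t. a < t \<Longrightarrow> t < b \<Longrightarrow> u t - v t > (l - k) / 2"
    by blast
  have int: "interval_lebesgue_integrable lborel (ereal a) (ereal b) u"
    "interval_lebesgue_integrable lborel (ereal a) (ereal b) v"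
    using locally_integrable_interval u v by auto
  have sint: "set_integrable lborel {a<..<b} (\<lambda>t. u t - v t)"
    using int ab(1) unfolding interval_lebesgue_integrable_def by simp
  define c where "c = (l - k) / 2"
  have cint: "set_integrable lborel {a<..<b} (\<lambda>_. c)"
    using borel_integrable_atLeastAtMost'[of a b "\<lambda>_. c"] by (rule set_integrable_subset) auto
  have "c * (b - a) = (LBINT t:{a<..<b}. c)"
    using interval_integral_const(2)[of a b c] interval_integral_Ioo[of a b "\<lambda>_. c"] ab(1) by simp
  also have "\<dots> \<le> (LBINT t:{a<..<b}. u t - v t)"
    using ab(2) by (intro set_integral_mono sint cint) (auto simp only: c_def less_imp_le greaterThanLessThan_iff)
  also have "\<dots> = (LBINT t=ereal a..ereal b. u t - v t)"
    using ab(1) by (simp add: interval_integral_Ioo)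
  also have "\<dots> = (LBINT t=ereal a..ereal b. u t) - (LBINT t=ereal a..ereal b. v t)"
    using int by simp
  also have "\<dots> = 0" unfolding interval_integral_difference[OF u] interval_integral_difference[OF v] eq by simp
  finally show False using \<open>\<not> l \<le> k\<close> ab(1) by (simp add: c_def mult_le_0_iff)
qed

lemma limit_eq_of_equal_integrals:
  fixes u v :: "real \<Rightarrow> real"
  assumes "locally_integrable u" "locally_integrable v"
    and "\<And>x. (LBINT t=0..ereal x. u t) = (LBINT t=0..ereal x. v t)"
    and "(u \<longlongrightarrow> l) F" "(v \<longlongrightarrow> k) F" "F = at_left x \<or> F = at_right x"
  shows "l = k"
  using limit_le_of_equal_integrals[OF assms]
    limit_le_of_equal_integrals[OF assms(2,1) assms(3)[symmetric] assms(5,4,6)] by simp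

lemma locally_integrable_I_op:
  assumes "g \<in> BV"
  shows "locally_integrable (\<lambda>t. I_op m g (ereal t))"
proof (induction m)
  case 0
  show ?case using locally_integrable_bounded[OF BV_measurable[OF assms] abs_BV_le_sup_norm[OF assms]] by simp
next
  case (Suc m)
  show ?case using locally_integrable_continuous[OF continuous_indefinite_integral[OF Suc]] by simp
qed

section \<open>Inverting the iterated integral\<close>

text \<open>From the second integration on the integrand is continuous, so its right limit is its
  value. The first integration, whose integrand may jump, is left to the injectivity lemma.\<close>

lemma I_op_Suc_eqD:
  assumes "g \<in> BV" "k \<in> BV" "\<And>x. I_op (Suc (Suc m)) g (ereal x) = I_op (Suc (Suc m)) k (ereal x)"
  shows "I_op (Suc m) g (ereal x) = I_op (Suc m) k (ereal x)"
proof -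
  have cont: "((\<lambda>t. I_op (Suc m) q (ereal t)) \<longlongrightarrow> I_op (Suc m) q (ereal x)) (at_right x)" if "q \<in> BV" for q
  proof -
    have "isCont (\<lambda>t. I_op (Suc m) q (ereal t)) x"
      using continuous_indefinite_integral[OF locally_integrable_I_op[OF that], of m]
      by (simp add: continuous_on_eq_continuous_at)
    then show ?thesis unfolding isCont_def filterlim_at_split by (rule conjunct2)
  qed
  have eq: "(LBINT t=0..ereal y. I_op (Suc m) g (ereal t)) = (LBINT t=0..ereal y. I_op (Suc m) k (ereal t))" for y
    using assms(3)[of y] by (simp only: I_op.simps)
  show ?thesis
    by (rule limit_eq_of_equal_integrals[OF locally_integrable_I_op[OF assms(1)]
          locally_integrable_I_op[OF assms(2)] eq cont[OF assms(1)] cont[OF assms(2)] disjI2[OF refl]])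
qed

lemma I_op_inj_on_NBV: "inj_on (I_op (Suc m)) (NBV lam)"
proof (rule inj_onI)
  fix g k assume gk: "g \<in> NBV lam" "k \<in> NBV lam" and eq: "I_op (Suc m) g = I_op (Suc m) k"
  have BV: "g \<in> BV" "k \<in> BV" using gk unfolding NBV_def by auto
  have "\<forall>x. I_op (Suc m) g (ereal x) = I_op (Suc m) k (ereal x)" using eq by simp
  then have "\<forall>x. I_op (Suc 0) g (ereal x) = I_op (Suc 0) k (ereal x)"
  proof (induction m)
    case (Suc m)
    then show ?case using I_op_Suc_eqD[OF BV, of m] by blast
  qed
  then have int: "(LBINT t=0..ereal x. g (ereal t)) = (LBINT t=0..ereal x. k (ereal t))" for x by simp
  note eqI = limit_eq_of_equal_integrals[OF locally_integrable_I_op[OF BV(1), of 0, simplified]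
      locally_integrable_I_op[OF BV(2), of 0, simplified] int]
  show "g = k"
  proof (rule NBV_eqI[OF gk])
    show "left_lim g x = left_lim k x" for x
      by (rule eqI[OF tendsto_left_lim[OF BV_regulated[OF BV(1)]]
            tendsto_left_lim[OF BV_regulated[OF BV(2)]] disjI1[OF refl]])
    show "right_lim g x = right_lim k x" for x
      by (rule eqI[OF tendsto_right_lim[OF BV_regulated[OF BV(1)]]
            tendsto_right_lim[OF BV_regulated[OF BV(2)]] disjI2[OF refl]])
  qed
qed

text \<open>The two integrands differ only at discontinuities of \<open>g\<close>, a countable set.
  Equality as functions on all of \<open>ereal\<close> is what \<open>inv_into\<close>
  requires.\<close>

lemma I_op_normalise:
  assumes "g \<in> BV"
  shows "I_op (Suc m) (normalise lam g) = I_op (Suc m) g"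
proof (induction m)
  case 0
  have "(LBINT t=0..x. normalise lam g (ereal t)) = (LBINT t=0..x. g (ereal t))" for x
    by (rule interval_integral_discrete_difference[OF BV_countable_discontinuities[OF assms]])
      (auto simp: normalise_eq_at_continuity simp del: normalise_simps)
  then show ?case by simp
next
  case (Suc m)
  then show ?case by (simp only: I_op.simps)
qed

lemma I_inv_I_op:
  assumes "g \<in> NBV lam"
  shows "I_inv lam m (I_op m g) = g"
proof (cases m)
  case (Suc j)
  show ?thesis unfolding I_inv_def Suc using inv_into_f_f[OF I_op_inj_on_NBV[of j] assms]
    by (simp del: I_op.simps)
qed (simp add: I_inv_def)

text \<open>\<open>normalise lam g\<close> is a preimage in \<open>NBV lam\<close>, and injectivity
  excludes any other.\<close>

lemma I_inv_I_op_BV: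
  assumes "g \<in> BV" "0 \<le> lam" "lam \<le> 1"
  shows "I_inv lam (Suc m) (I_op (Suc m) g) = normalise lam g"
  using I_inv_I_op[OF normalise_NBV[OF assms], of "Suc m"] unfolding I_op_normalise[OF assms(1)] .

section \<open>Smooth functions\<close>

definition smooth :: "(real \<Rightarrow> real) \<Rightarrow> bool" where
  "smooth f \<longleftrightarrow> (\<forall>k x. (deriv ^^ k) f differentiable (at x))"

lemma smooth_deriv: "smooth f \<Longrightarrow> smooth (deriv f)"
  unfolding smooth_def by (metis comp_apply funpow_Suc_right)

lemma smooth_DERIV: "smooth f \<Longrightarrow> (f has_real_derivative deriv f x) (at x)"
  unfolding smooth_def DERIV_deriv_iff_real_differentiable by (metis funpow_0)

text \<open>Coinduction spares formulas for iterated derivatives: one differentiation that stays in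
  the class is enough.\<close>

lemma smooth_coinduct:
  assumes "P f" and step: "\<And>f. P f \<Longrightarrow> \<exists>f'. P f' \<and> (\<forall>x. (f has_real_derivative f' x) (at x))"
  shows "smooth f"
proof -
  have P_deriv: "P (deriv f)" if "P f" for f
  proof -
    obtain f' where f': "P f'" "\<And>x. (f has_real_derivative f' x) (at x)" using step[OF \<open>P f\<close>] by blast
    have "deriv f = f'" using DERIV_imp_deriv[OF f'(2)] by blast
    then show ?thesis using f'(1) by simp
  qed
  have "P ((deriv ^^ k) f)" for k by (induction k) (use \<open>P f\<close> P_deriv in auto)
  then show ?thesis unfolding smooth_def real_differentiable_def using step by blast
qed

text \<open>The derivative of a product or of \<open>flat k\<close> is a combination of two
  generators rather than a generator, hence the linear span.\<close>

inductive_set function_span :: "(real \<Rightarrow> real) set \<Rightarrow> (real \<Rightarrow> real) set" for C where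
  base: "f \<in> C \<Longrightarrow> f \<in> function_span C"
| comb: "f \<in> function_span C \<Longrightarrow> g \<in> function_span C \<Longrightarrow> (\<lambda>x. a * f x + b * g x) \<in> function_span C"

lemma smooth_spanI:
  assumes C: "\<And>f. f \<in> C \<Longrightarrow> \<exists>f'\<in>function_span C. \<forall>x. (f has_real_derivative f' x) (at x)"
    and "f \<in> C"
  shows "smooth f"
proof (rule smooth_coinduct[where P = "\<lambda>f. f \<in> function_span C"])
  show "f \<in> function_span C" using \<open>f \<in> C\<close> by (rule function_span.base)
  fix f assume "f \<in> function_span C"
  then show "\<exists>f'. f' \<in> function_span C \<and> (\<forall>x. (f has_real_derivative f' x) (at x))"
  proof (induction rule: function_span.induct)
    case (base f)
    then show ?case using C by blast
  next
    case (comb f g a b)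
    obtain f' where f': "f' \<in> function_span C" "\<And>x. (f has_real_derivative f' x) (at x)"
      using comb.IH(1) by blast
    obtain g' where g': "g' \<in> function_span C" "\<And>x. (g has_real_derivative g' x) (at x)"
      using comb.IH(2) by blast
    have "((\<lambda>x. a * f x + b * g x) has_real_derivative a * f' x + b * g' x) (at x)" for x
      by (intro DERIV_add DERIV_cmult f' g')
    moreover have "(\<lambda>x. a * f' x + b * g' x) \<in> function_span C"
      by (rule function_span.comb[OF f'(1) g'(1)])
    ultimately show ?case by (intro exI[of _ "\<lambda>x. a * f' x + b * g' x"]) simp
  qed
qed

lemma smooth_mult:
  assumes "smooth f" "smooth g"
  shows "smooth (\<lambda>x. f x * g x)"
proof -
  define C where "C = {\<lambda>x. f x * g x | f g. smooth f \<and> smooth g}"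
  show ?thesis
  proof (rule smooth_spanI[of C])
    show "(\<lambda>x. f x * g x) \<in> C" unfolding C_def using assms by blast
    fix u assume "u \<in> C"
    then obtain f g where u: "u = (\<lambda>x. f x * g x)" "smooth f" "smooth g" unfolding C_def by blast
    have "(\<lambda>x. deriv f x * g x) \<in> C" "(\<lambda>x. f x * deriv g x) \<in> C"
      unfolding C_def using u smooth_deriv by blast+
    then have mem: "(\<lambda>x. 1 * (deriv f x * g x) + 1 * (f x * deriv g x)) \<in> function_span C"
      by (intro function_span.intros)
    have D: "(u has_real_derivative 1 * (deriv f x * g x) + 1 * (f x * deriv g x)) (at x)" for x
      unfolding u(1) using DERIV_mult[OF smooth_DERIV[OF u(2)] smooth_DERIV[OF u(3)], of x]
      by (simp add: algebra_simps)
    show "\<exists>f'\<in>function_span C. \<forall>x. (u has_real_derivative f' x) (at x)"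
      by (intro bexI[OF _ mem] allI D)
  qed
qed

lemma smooth_affine:
  assumes "smooth f"
  shows "smooth (\<lambda>x. f (c * x + d))"
proof -
  define C where "C = {\<lambda>x. f (c * x + d) | f. smooth f}"
  show ?thesis
  proof (rule smooth_spanI[of C])
    show "(\<lambda>x. f (c * x + d)) \<in> C" unfolding C_def using assms by blast
    fix u assume "u \<in> C"
    then obtain f where u: "u = (\<lambda>x. f (c * x + d))" "smooth f" unfolding C_def by blast
    have "(\<lambda>x. deriv f (c * x + d)) \<in> C" unfolding C_def using u smooth_deriv by blast
    \<comment> \<open>Scaling by \<open>c\<close> is available only through the binary rule
      \<open>comb\<close>, which explains the summand with coefficient \<open>0\<close>.\<close>
    then have mem: "(\<lambda>x. c * deriv f (c * x + d) + 0 * deriv f (c * x + d)) \<in> function_span C"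
      by (intro function_span.intros)
    have D: "(u has_real_derivative c * deriv f (c * x + d) + 0 * deriv f (c * x + d)) (at x)" for x
    proof -
      have "((\<lambda>x. c * x + d) has_real_derivative c) (at x)" by (auto intro!: derivative_eq_intros)
      from DERIV_chain2[OF smooth_DERIV[OF u(2)] this] show ?thesis unfolding u(1) by (simp add: mult.commute)
    qed
    show "\<exists>f'\<in>function_span C. \<forall>x. (u has_real_derivative f' x) (at x)"
      by (intro bexI[OF _ mem] allI D)
  qed
qed

section \<open>Flat functions and bumps\<close>

text \<open>For \<open>k = 0\<close> this is the classical smooth function that is not analytic at
  \<open>0\<close>. The powers are included because differentiation leads from \<open>k\<close> to
  \<open>k + 1\<close> and \<open>k + 2\<close>.\<close>

definition flat :: "nat \<Rightarrow> real \<Rightarrow> real" where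
  "flat k x = (if x > 0 then inverse x ^ k * exp (- inverse x) else 0)"

lemma flat_tendsto_0: "(flat k \<longlongrightarrow> 0) (at 0)"
  unfolding filterlim_at_split
proof
  show "(flat k \<longlongrightarrow> 0) (at_left 0)"
    by (rule tendsto_eventually) (auto simp: flat_def eventually_at_filter)
  have "((\<lambda>x. inverse x ^ k / exp (inverse x)) \<longlongrightarrow> 0) (at_right (0::real))"
    by (rule filterlim_compose[OF tendsto_power_div_exp_0 filterlim_inverse_at_top_right])
  then show "(flat k \<longlongrightarrow> 0) (at_right 0)"
    by (rule Lim_transform_eventually) (auto simp: flat_def eventually_at_filter exp_minus divide_inverse)
qed

lemma DERIV_flat:
  "(flat k has_real_derivative 1 * flat (k + 2) x + (- real k) * flat (k + 1) x) (at x)"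
proof -
  consider "x > 0" | "x < 0" | "x = 0" by linarith
  then show ?thesis
  proof cases
    case 1
    have "((\<lambda>x. inverse x ^ k * exp (- inverse x)) has_real_derivative
       real k * (- (inverse x ^ 2) * inverse x ^ (k - 1)) * exp (- inverse x)
         + inverse x ^ k * (exp (- inverse x) * inverse x ^ 2)) (at x)"
      using 1 by (auto intro!: derivative_eq_intros simp: power2_eq_square)
    \<comment> \<open>For \<open>k = 0\<close> the exponent \<open>k - 1\<close> is truncated, which
      is harmless because of the factor \<open>real k\<close>.\<close>
    moreover have "real k * (- (inverse x ^ 2) * inverse x ^ (k - 1)) * exp (- inverse x)
         + inverse x ^ k * (exp (- inverse x) * inverse x ^ 2) =
       1 * flat (k + 2) x + (- real k) * flat (k + 1) x"
      using 1 by (cases k) (auto simp: flat_def power2_eq_square algebra_simps)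
    ultimately have "((\<lambda>x. inverse x ^ k * exp (- inverse x)) has_real_derivative
       1 * flat (k + 2) x + (- real k) * flat (k + 1) x) (at x)" by simp
    then show ?thesis
      by (rule has_field_derivative_transform_within_open[of _ _ _ "{0<..}"]) (use 1 in \<open>auto simp: flat_def\<close>)
  next
    case 2
    have "((\<lambda>x. 0) has_real_derivative 1 * flat (k + 2) x + (- real k) * flat (k + 1) x) (at x)"
      using 2 by (simp add: flat_def)
    then show ?thesis
      by (rule has_field_derivative_transform_within_open[of _ _ _ "{..<0}"]) (use 2 in \<open>auto simp: flat_def\<close>)
  next
    case 3
    \<comment> \<open>The difference quotient of \<open>flat k\<close> at \<open>0\<close> is
      \<open>flat (Suc k)\<close>.\<close>
    have "((\<lambda>h. (flat k (0 + h) - flat k 0) / h) \<longlongrightarrow> 0) (at 0)"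
      by (rule Lim_transform_eventually[OF flat_tendsto_0[of "Suc k"]])
        (auto simp: flat_def eventually_at_filter field_simps)
    then show ?thesis using 3 by (simp add: DERIV_def flat_def)
  qed
qed

lemma smooth_flat: "smooth (flat k)"
proof (rule smooth_spanI[of "range flat"])
  fix u assume "u \<in> range flat"
  then obtain j where u: "u = flat j" by blast
  have mem: "(\<lambda>x. 1 * flat (j + 2) x + (- real j) * flat (j + 1) x) \<in> function_span (range flat)"
    by (intro function_span.intros rangeI)
  show "\<exists>f'\<in>function_span (range flat). \<forall>x. (u has_real_derivative f' x) (at x)"
    unfolding u by (intro bexI[OF _ mem] allI DERIV_flat)
qed simp

lemma test_function_iff:
  "test_function \<phi> \<longleftrightarrow> smooth \<phi> \<and> (\<exists>a b. \<forall>x. x \<notin> {a..b} \<longrightarrow> \<phi> x = 0)"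
  unfolding test_function_def smooth_def ..

lemma bump_function:
  obtains \<phi> where "test_function \<phi>" "\<And>x. 0 \<le> \<phi> x" "\<And>x. \<phi> x > 0 \<longleftrightarrow> a < x \<and> x < b"
proof
  \<comment> \<open>This is \<open>flat 0 (x - a) * flat 0 (b - x)\<close> in the shape that
    \<open>smooth_affine\<close> expects.\<close>
  let ?\<phi> = "\<lambda>x. flat 0 (1 * x + (- a)) * flat 0 ((- 1) * x + b)"
  have "smooth ?\<phi>" by (intro smooth_mult smooth_affine smooth_flat)
  then show "test_function ?\<phi>" unfolding test_function_iff
    by (intro conjI exI[of _ a] exI[of _ b]) (auto simp: flat_def)
qed (auto simp: flat_def)

section \<open>Uniqueness of the primitive\<close>

lemma test_function_deriv:
  assumes "test_function \<phi>"
  shows "test_function (deriv \<phi>)"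
proof -
  obtain a b where ab: "\<And>x. x \<notin> {a..b} \<Longrightarrow> \<phi> x = 0" and sm: "smooth \<phi>"
    using assms unfolding test_function_iff by blast
  have "deriv \<phi> x = 0" if "x \<notin> {a..b}" for x
  proof (rule DERIV_imp_deriv)
    have "((\<lambda>x. 0) has_real_derivative 0) (at x)" by simp
    then show "(\<phi> has_real_derivative 0) (at x)"
      by (rule has_field_derivative_transform_within_open[of _ _ _ "- {a..b}"])
        (use that ab in \<open>auto simp: open_Compl\<close>)
  qed
  then show ?thesis unfolding test_function_iff using smooth_deriv[OF sm] by blast
qed

lemma test_function_higher_deriv: "test_function \<phi> \<Longrightarrow> test_function ((deriv ^^ k) \<phi>)"
  by (induction k) (auto intro: test_function_deriv)

lemma test_function_integrable:
  assumes "test_function \<phi>"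
  shows "integrable lborel \<phi>"
proof -
  obtain a b where ab: "\<And>x. x \<notin> {a..b} \<Longrightarrow> \<phi> x = 0" and sm: "smooth \<phi>"
    using assms unfolding test_function_iff by blast
  have "continuous_on {a..b} \<phi>"
    using smooth_DERIV[OF sm] by (intro DERIV_continuous_on) (rule has_field_derivative_at_within)
  from borel_integrable_atLeastAtMost'[OF this] have "integrable lborel (\<lambda>x. indicator {a..b} x *\<^sub>R \<phi> x)"
    unfolding set_integrable_def .
  also have "(\<lambda>x. indicator {a..b} x *\<^sub>R \<phi> x) = \<phi>"
    using ab by (auto simp: indicator_def fun_eq_iff)
  finally show ?thesis .
qed

lemma integrable_bounded_mult:
  fixes G \<phi> :: "real \<Rightarrow> real"
  assumes "G \<in> borel_measurable borel" "\<And>x. \<bar>G x\<bar> \<le> M" "integrable lborel \<phi>"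
  shows "integrable lborel (\<lambda>x. G x * \<phi> x)"
proof (rule Bochner_Integration.integrable_bound)
  show "integrable lborel (\<lambda>x. M * \<phi> x)" using assms(3) by simp
  have "\<phi> \<in> borel_measurable borel" using borel_measurable_integrable[OF assms(3)] by simp
  then show "(\<lambda>x. G x * \<phi> x) \<in> borel_measurable lborel" using assms(1) by simp
  show "AE x in lborel. norm (G x * \<phi> x) \<le> norm (M * \<phi> x)"
    using order_trans[OF assms(2) abs_ge_self] by (intro AE_I2) (auto simp: abs_mult intro: mult_right_mono)
qed

lemma higher_deriv_shift_difference:
  assumes "smooth \<phi>"
  shows "(deriv ^^ k) (\<lambda>x. \<phi> (x + T) - \<phi> x) = (\<lambda>x. (deriv ^^ k) \<phi> (x + T) - (deriv ^^ k) \<phi> x)"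
  using assms
proof (induction k arbitrary: \<phi>)
  case (Suc k)
  have "deriv (\<lambda>x. \<phi> (x + T) - \<phi> x) = (\<lambda>x. deriv \<phi> (x + T) - deriv \<phi> x)"
  proof
    fix x
    have "((\<lambda>x. \<phi> (x + T)) has_real_derivative deriv \<phi> (x + T)) (at x)"
      using smooth_DERIV[OF Suc.prems, of "x + T"] by (simp add: DERIV_shift)
    from DERIV_imp_deriv[OF DERIV_diff[OF this smooth_DERIV[OF Suc.prems]]]
    show "deriv (\<lambda>x. \<phi> (x + T) - \<phi> x) x = deriv \<phi> (x + T) - deriv \<phi> x" .
  qed
  then show ?case using Suc.IH[OF smooth_deriv[OF Suc.prems]] by (simp add: funpow_swap1)
qed simp

text \<open>The difference of two translates has integral zero, so its suitable antiderivative has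
  bounded support again.\<close>

lemma shift_difference_antiderivative:
  assumes \<phi>: "test_function \<phi>"
  obtains \<Phi> where "test_function \<Phi>" "deriv \<Phi> = (\<lambda>x. \<phi> (x + T) - \<phi> x)"
proof -
  obtain a b where ab: "\<And>x. x \<notin> {a..b} \<Longrightarrow> \<phi> x = 0" and sm: "smooth \<phi>"
    using \<phi> unfolding test_function_iff by blast
  have "\<exists>P. \<forall>x::real. - \<infinity> < ereal x \<longrightarrow> ereal x < \<infinity> \<longrightarrow> (P has_vector_derivative \<phi> x) (at x)"
    by (rule einterval_antiderivative) (auto intro: DERIV_isCont[OF smooth_DERIV[OF sm]])
  then obtain P where P: "\<And>x. (P has_real_derivative \<phi> x) (at x)"
    by (auto simp: has_real_derivative_iff_has_vector_derivative)
  define \<Phi> where "\<Phi> x = P (x + T) - P x" for x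
  have D: "(\<Phi> has_real_derivative \<phi> (x + T) - \<phi> x) (at x)" for x
  proof -
    have "((\<lambda>x. P (x + T)) has_real_derivative \<phi> (x + T)) (at x)" using P[of "x + T"] by (simp add: DERIV_shift)
    from DERIV_diff[OF this P] show ?thesis unfolding \<Phi>_def .
  qed
  then have deriv: "deriv \<Phi> = (\<lambda>x. \<phi> (x + T) - \<phi> x)" using DERIV_imp_deriv by blast
  have "smooth (deriv \<Phi>)" unfolding smooth_def deriv higher_deriv_shift_difference[OF sm]
  proof (intro allI)
    fix k x
    have "((deriv ^^ k) \<phi> has_real_derivative deriv ((deriv ^^ k) \<phi>) y) (at y)" for y
      using smooth_DERIV test_function_higher_deriv[OF \<phi>] unfolding test_function_iff by blast
    then show "(\<lambda>x. (deriv ^^ k) \<phi> (x + T) - (deriv ^^ k) \<phi> x) differentiable at x"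
      unfolding real_differentiable_def using DERIV_diff DERIV_shift by blast
  qed
  have "smooth \<Phi>" unfolding smooth_def
  proof (intro allI)
    fix k x
    show "(deriv ^^ k) \<Phi> differentiable at x"
    proof (cases k)
      case 0
      then show ?thesis using D real_differentiable_def by auto
    next
      case (Suc j)
      then show ?thesis
        using \<open>smooth (deriv \<Phi>)\<close> unfolding smooth_def Suc funpow_Suc_right comp_apply by blast
    qed
  qed
  \<comment> \<open>The interval covers \<open>[a, b]\<close> and \<open>[a - T, b - T]\<close>.
    Outside it \<open>x\<close> and \<open>x + T\<close> lie on the same side of
    \<open>[a, b]\<close>, where \<open>P\<close> is constant.\<close>
  moreover have "\<Phi> x = 0" if "x \<notin> {min a (a - T)..max b (b - T)}" for x
  proof -
    have const: "P u = P v" if "u < v" "v < a \<or> u > b" for u v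
    proof -
      have "(P has_real_derivative 0) (at t)" if "u \<le> t" "t \<le> v" for t
        using P[of t] ab[of t] that \<open>v < a \<or> u > b\<close> by auto
      from DERIV_isconst_end[OF \<open>u < v\<close> _ this] show ?thesis
        using DERIV_isCont[OF P] by (simp add: continuous_at_imp_continuous_on)
    qed
    have out: "x < min a (a - T) \<or> x > max b (b - T)" using that by auto
    have "P (x + T) = P x"
    proof (cases T "0 :: real" rule: linorder_cases)
      case less
      then show ?thesis using out by (intro const) auto
    next
      case greater
      then show ?thesis using out by (intro const[symmetric]) auto
    qed simp
    then show ?thesis unfolding \<Phi>_def by simp
  qed
  ultimately show thesis using that deriv unfolding test_function_iff by blast
qed

text \<open>Testing against an antiderivative of the difference of two translates of \<open>\<phi>\<close> shows that
  the integral is invariant under translation of \<open>G\<close>; translating towards \<open>-\<infinity>\<close> gives \<open>0\<close>.\<close>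

lemma vanishing_derivative_step:
  fixes G :: "real \<Rightarrow> real"
  assumes meas: "G \<in> borel_measurable borel" and bound: "\<And>x. \<bar>G x\<bar> \<le> M"
    and lim: "(G \<longlongrightarrow> 0) at_bot"
    and zero: "\<And>\<phi>. test_function \<phi> \<Longrightarrow> (LBINT x. G x * (deriv ^^ Suc k) \<phi> x) = 0"
    and \<phi>: "test_function \<phi>"
  shows "(LBINT x. G x * (deriv ^^ k) \<phi> x) = 0"
proof -
  define \<psi> where "\<psi> = (deriv ^^ k) \<phi>"
  have \<psi>: "integrable lborel \<psi>" unfolding \<psi>_def
    by (intro test_function_integrable test_function_higher_deriv \<phi>)
  have shift: "(LBINT x. G x * \<psi> x) = (LBINT y. G (y - T) * \<psi> y)" for T
  proof -
    obtain \<Phi> where \<Phi>: "test_function \<Phi>" "deriv \<Phi> = (\<lambda>x. \<phi> (x + T) - \<phi> x)"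
      by (rule shift_difference_antiderivative[OF \<phi>])
    have "smooth \<phi>" using \<phi> unfolding test_function_iff by simp
    then have "(deriv ^^ Suc k) \<Phi> = (\<lambda>x. \<psi> (x + T) - \<psi> x)"
      unfolding funpow_Suc_right comp_apply \<Phi>(2) \<psi>_def by (rule higher_deriv_shift_difference)
    then have "0 = (LBINT x. G x * \<psi> (x + T) - G x * \<psi> x)"
      using zero[OF \<Phi>(1)] by (simp add: right_diff_distrib)
    also have "\<dots> = (LBINT x. G x * \<psi> (x + T)) - (LBINT x. G x * \<psi> x)"
      using lborel_integrable_real_affine[OF \<psi>, of 1 T]
      by (intro Bochner_Integration.integral_diff integrable_bounded_mult[OF meas bound] \<psi>)
        (simp add: add.commute)
    finally have "(LBINT x. G x * \<psi> x) = (LBINT x. G x * \<psi> (x + T))" by simp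
    also have "\<dots> = (LBINT y. G (y - T) * \<psi> y)"
      using lborel_integral_real_affine[of 1 "\<lambda>x. G x * \<psi> (x + T)" "- T"] by simp
    finally show ?thesis .
  qed
  have "(\<lambda>n::nat. LBINT y. G (y - real n) * \<psi> y) \<longlonglongrightarrow> (LBINT y. 0 * \<psi> y)"
  proof (rule integral_dominated_convergence)
    have \<psi>m: "\<psi> \<in> borel_measurable borel" using borel_measurable_integrable[OF \<psi>] by simp
    show "(\<lambda>y. G (y - real n) * \<psi> y) \<in> borel_measurable lborel" for n
      using meas \<psi>m by simp
    show "integrable lborel (\<lambda>y. M * \<bar>\<psi> y\<bar>)" using \<psi> by simp
    show "AE y in lborel. norm (G (y - real n) * \<psi> y) \<le> M * \<bar>\<psi> y\<bar>" for n
      using bound by (intro AE_I2) (auto simp: abs_mult intro: mult_right_mono)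
    have "(\<lambda>n::nat. G (y - real n)) \<longlonglongrightarrow> 0" for y
    proof (rule filterlim_compose[OF lim])
      show "filterlim (\<lambda>n. y - real n) at_bot sequentially"
        using filterlim_tendsto_add_at_top[OF tendsto_const[of "- y"] filterlim_real_sequentially]
        unfolding filterlim_uminus_at_bot by simp
    qed
    then show "AE y in lborel. (\<lambda>n. G (y - real n) * \<psi> y) \<longlonglongrightarrow> 0 * \<psi> y"
      by (intro AE_I2 tendsto_mult_right)
  qed simp
  then show ?thesis using shift unfolding \<psi>_def by (simp add: LIMSEQ_const_iff)
qed

text \<open>A vanishing \<open>n\<close>-th derivative leaves a polynomial of degree below
  \<open>n\<close>, and the limit \<open>0\<close> at \<open>-\<infinity>\<close> rules out all but
  zero. Each step frees the test functions from one derivative while \<open>G\<close> stays the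
  same.\<close>

lemma vanishing_derivative:
  fixes G :: "real \<Rightarrow> real"
  assumes meas: "G \<in> borel_measurable borel" and bound: "\<And>x. \<bar>G x\<bar> \<le> M"
    and lim: "(G \<longlongrightarrow> 0) at_bot"
    and zero: "\<And>\<phi>. test_function \<phi> \<Longrightarrow> (LBINT x. G x * (deriv ^^ n) \<phi> x) = 0"
    and \<phi>: "test_function \<phi>"
  shows "(LBINT x. G x * \<phi> x) = 0"
  using zero \<phi>
proof (induction n arbitrary: \<phi>)
  case (Suc n)
  show ?case using Suc.IH[OF vanishing_derivative_step[OF meas bound lim Suc.prems(1)] Suc.prems(2)] by blast
qed simp

lemma distr_deriv_power:
  assumes "test_function \<phi>"
  shows "(distr_deriv ^^ n) (distr_of F) \<phi> = (- 1) ^ n * (LBINT x. F (ereal x) * (deriv ^^ n) \<phi> x)"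
  using assms
proof (induction n arbitrary: \<phi>)
  case 0
  then show ?case by (simp add: distr_of_def)
next
  case (Suc n)
  then show ?case using Suc.IH[OF test_function_deriv[OF Suc.prems]]
    by (simp add: distr_deriv_def funpow_swap1)
qed

text \<open>The bump sits on an interval that ends at \<open>x\<close>, the side on which left
  continuity keeps the sign of \<open>G\<close>.\<close>

lemma left_continuous_zero:
  fixes G :: "real \<Rightarrow> real"
  assumes meas: "G \<in> borel_measurable borel" and bound: "\<And>x. \<bar>G x\<bar> \<le> M"
    and left: "(G \<longlongrightarrow> G x) (at_left x)"
    and zero: "\<And>\<phi>. test_function \<phi> \<Longrightarrow> (LBINT x. G x * \<phi> x) = 0"
  shows "G x = 0"
proof (rule ccontr)
  assume "G x \<noteq> 0"
  \<comment> \<open>Multiplying by \<open>G x\<close> treats both signs at once.\<close>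
  then have "G x * G x > 0" by (auto simp: zero_less_mult_iff linorder_neq_iff)
  with tendsto_mult_left[OF left] have "eventually (\<lambda>t. G x * G t > 0) (at_left x)" by (rule order_tendstoD)
  then obtain a where a: "a < x" "\<And>t. a < t \<Longrightarrow> t < x \<Longrightarrow> G x * G t > 0"
    unfolding eventually_at_left_field by blast
  obtain \<phi> where \<phi>: "test_function \<phi>" "\<And>t. 0 \<le> \<phi> t" "\<And>t. \<phi> t > 0 \<longleftrightarrow> a < t \<and> t < x"
    using bump_function[of a x] by blast
  have \<phi>0: "\<phi> t = 0" if "\<not> (a < t \<and> t < x)" for t using \<phi>(2,3)[of t] that by simp
  have nonneg: "0 \<le> G x * (G t * \<phi> t)" for t
    using a(2)[of t] \<phi>(2)[of t] \<phi>0[of t] mult_nonneg_nonneg[of "G x * G t" "\<phi> t"]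
    by (cases "a < t \<and> t < x") (simp_all add: mult.assoc)
  have int: "integrable lborel (\<lambda>t. G x * (G t * \<phi> t))"
    by (intro integrable_mult_right integrable_bounded_mult[OF meas bound] test_function_integrable \<phi>(1))
  have "(LBINT t. G x * (G t * \<phi> t)) = 0" using zero[OF \<phi>(1)] by simp
  then have "AE t in lborel. G x * (G t * \<phi> t) = 0"
    using integral_nonneg_eq_0_iff_AE[OF int] nonneg by simp
  then have "AE t in lborel. t \<notin> {a<..<x}"
  proof (rule AE_mp, intro AE_I2 impI notI)
    fix t assume "G x * (G t * \<phi> t) = 0" "t \<in> {a<..<x}"
    then show False using a(2)[of t] \<phi>(3)[of t] by auto
  qed
  then have "{a<..<x} \<in> null_sets lborel" using AE_iff_null_sets[of "{a<..<x}" lborel] by simp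
  then show False using a(1) by (simp add: null_sets_def)
qed

lemma B_r_left_continuous: "F \<in> B_r \<Longrightarrow> ((\<lambda>t. F (ereal t)) \<longlongrightarrow> F (ereal x)) (at_left x)"
  using tendsto_left_lim[of F x] unfolding B_r_def by simp

text \<open>Equality of the distributions says that \<open>F - K\<close> integrates to zero against
  all \<open>n\<close>-th derivatives of test functions. This settles the real points; the ends
  follow from the common value at \<open>-\<infinity>\<close> and the limit at
  \<open>\<infinity>\<close>.\<close>

lemma primitive_unique:
  assumes F: "F \<in> B_r" and K: "K \<in> B_r"
    and eq: "(distr_deriv ^^ n) (distr_of F) = (distr_deriv ^^ n) (distr_of K)"
  shows "F = K"
proof -
  define G where "G t = F (ereal t) - K (ereal t)" for t
  obtain M where M: "\<And>x. \<bar>F x\<bar> \<le> M" using B_r_bounded[OF F] by blast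
  obtain N where N: "\<And>x. \<bar>K x\<bar> \<le> N" using B_r_bounded[OF K] by blast
  have meas: "G \<in> borel_measurable borel"
    unfolding G_def by (intro borel_measurable_diff B_r_measurable F K)
  have bound: "\<bar>G t\<bar> \<le> M + N" for t unfolding G_def using M[of "ereal t"] N[of "ereal t"] by linarith
  have ends: "ends_are_limits F" "ends_are_limits K" "F (-\<infinity>) = 0" "K (-\<infinity>) = 0"
    using F K unfolding B_r_def regulated_def by auto
  have lim: "(G \<longlongrightarrow> 0) at_bot"
    using tendsto_diff[of "\<lambda>t. F (ereal t)" 0 at_bot "\<lambda>t. K (ereal t)" 0] ends
    unfolding G_def ends_are_limits_def by simp
  have "(LBINT x. G x * (deriv ^^ n) \<phi> x) = 0" if \<phi>: "test_function \<phi>" for \<phi>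
  proof -
    note int = test_function_integrable[OF test_function_higher_deriv[OF \<phi>]]
    have "(LBINT x. F (ereal x) * (deriv ^^ n) \<phi> x) = (LBINT x. K (ereal x) * (deriv ^^ n) \<phi> x)"
      using fun_cong[OF eq, of \<phi>] unfolding distr_deriv_power[OF \<phi>] by simp
    moreover have "(LBINT x. G x * (deriv ^^ n) \<phi> x) =
        (LBINT x. F (ereal x) * (deriv ^^ n) \<phi> x) - (LBINT x. K (ereal x) * (deriv ^^ n) \<phi> x)"
      unfolding G_def left_diff_distrib
      by (intro Bochner_Integration.integral_diff integrable_bounded_mult[OF B_r_measurable[OF F] M int]
          integrable_bounded_mult[OF B_r_measurable[OF K] N int])
    ultimately show ?thesis by simp
  qed
  from vanishing_derivative[OF meas bound lim this]
  have zero: "(LBINT x. G x * \<phi> x) = 0" if "test_function \<phi>" for \<phi> using that by blast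
  have "G x = 0" for x
  proof (rule left_continuous_zero[OF meas bound _ zero])
    show "(G \<longlongrightarrow> G x) (at_left x)"
      unfolding G_def by (intro tendsto_diff B_r_left_continuous F K)
  qed
  then have r: "F (ereal x) = K (ereal x)" for x unfolding G_def by simp
  have "((\<lambda>t. F (ereal t)) \<longlongrightarrow> F \<infinity>) at_top" "((\<lambda>t. F (ereal t)) \<longlongrightarrow> K \<infinity>) at_top"
    using ends unfolding ends_are_limits_def r by blast+
  then have "F \<infinity> = K \<infinity>" using tendsto_unique by (metis trivial_limit_at_top_linorder)
  then have "F x = K x" for x using r ends by (cases x) auto
  then show ?thesis by blast
qed

lemma primitive_eq:
  assumes "F \<in> B_r"
  shows "primitive n ((distr_deriv ^^ n) (distr_of F)) = F"
  unfolding primitive_def using assms primitive_unique by blast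

text \<open>For \<open>n \<ge> 2\<close> the function \<open>h\<close> determines \<open>g\<close>
  only up to countably many values. If \<open>g\<close> is the indicator of one real point, then
  \<open>h\<close> is zero and has norm \<open>0\<close>, while \<open>BV_norm g\<close> is
  \<open>3\<close>. Hence the two right-hand sides are compared by an inequality, and equality is
  claimed where \<open>I_inv\<close> returns \<open>g\<close> itself.\<close>

theorem theorem18:
  fixes n :: nat and lam :: real
    and f :: "(real \<Rightarrow> real) \<Rightarrow> real" and F g h :: "ereal \<Rightarrow> real"
  assumes "n \<ge> 1" and "0 \<le> lam" and "lam \<le> 1"
    and "f \<in> A_r n" and "F \<in> B_r" and "f = (distr_deriv ^^ n) (distr_of F)"
    and "h \<in> IBV (n - 1)" and "g \<in> BV" and "h = I_op (n - 1) g"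
  shows "\<bar>A_integral lam n f h\<bar> \<le> sup_norm F * BV_norm g \<and>
         \<bar>A_integral lam n f h\<bar> \<le> A_norm n f * IBV_norm lam (n - 1) h \<and>
         A_norm n f * IBV_norm lam (n - 1) h \<le> sup_norm F * BV_norm g \<and>
         (n = 1 \<or> g \<in> NBV lam \<longrightarrow>
            sup_norm F * BV_norm g = A_norm n f * IBV_norm lam (n - 1) h)"
proof -
  have prim: "primitive n f = F" unfolding assms(6) by (rule primitive_eq[OF assms(5)])
  define g0 where "g0 = I_inv lam (n - 1) h"
  have g0: "g0 \<in> BV \<and> BV_norm g0 \<le> BV_norm g"
  proof (cases "n - 1")
    case 0
    then have "g0 = g" unfolding g0_def assms(9) I_inv_def by simp
    then show ?thesis using assms(8) by simp
  next
    case (Suc m)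
    then have "g0 = normalise lam g"
      unfolding g0_def assms(9) using I_inv_I_op_BV[OF assms(8,2,3), of m] by simp
    then show ?thesis
      using normalise_NBV[OF assms(8,2,3)] BV_norm_normalise_le[OF assms(8,2,3)] unfolding NBV_def by simp
  qed
  have F_nonneg: "0 \<le> sup_norm F" using abs_B_r_le_sup_norm[OF assms(5), of 0] by linarith
  have "\<bar>A_integral lam n f h\<bar> = \<bar>HS_integral g0 F\<bar>"
    unfolding A_integral_def prim g0_def by (simp add: abs_mult power_abs)
  also have "\<dots> \<le> sup_norm F * BV_norm g0" using g0 assms(5) by (intro HS_integral_bound) auto
  finally have bound: "\<bar>A_integral lam n f h\<bar> \<le> A_norm n f * IBV_norm lam (n - 1) h"
    unfolding A_norm_def IBV_norm_def prim g0_def .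
  have le: "A_norm n f * IBV_norm lam (n - 1) h \<le> sup_norm F * BV_norm g"
    unfolding A_norm_def IBV_norm_def prim g0_def[symmetric]
    using g0 F_nonneg by (intro mult_left_mono) auto
  have "g0 = g" if "n = 1 \<or> g \<in> NBV lam"
    using that
  proof
    assume "n = 1"
    then show ?thesis unfolding g0_def assms(9) I_inv_def by simp
  next
    assume "g \<in> NBV lam"
    then show ?thesis unfolding g0_def assms(9) by (rule I_inv_I_op)
  qed
  then have "n = 1 \<or> g \<in> NBV lam \<longrightarrow> sup_norm F * BV_norm g = A_norm n f * IBV_norm lam (n - 1) h"
    unfolding A_norm_def IBV_norm_def prim g0_def[symmetric] by auto
  then show ?thesis using bound le by linarith
qed

end
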